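(* Let $G$ be the Grigorchuk--Erschler group and let $B=\mathrm{Bas}_2(G)$ be its second Basilica group. Then $B$ has maximal subgroups of infinite index.
   Context: Let $T$ be the binary rooted tree: its vertices are the finite words over $X=\{0,1\}$, the root is the empty word $\epsilon$, and each word $v$ is joined to $v0$ and $v1$. $\mathrm{Aut}\,T$ is the group of root-fixing graph automorphisms of $T$, acting on the left. For $g\in\mathrm{Aut}\,T$ and a vertex $v$, the section $g|_v\in\mathrm{Aut}\,T$ is defined by $g(vw)=g(v)\,g|_v(w)$ for all words $w$. One writes $g=(g|_0,g|_1)\,g|^\epsilon$, where $g|^\epsilon\in\mathrm{Sym}(\{0,1\})$ is the action of $g$ on the first level; $(x,y)$ denotes the automorphism fixing $0$ and $1$ with sections $x$ at $0$ and $y$ at $1$; $\tau$ is the non-trivial permutation of $\{0,1\}$. The Grigorchuk--Erschler group is $G=\langle a,b_0,b_1\rangle\le\mathrm{Aut}\,T$ with $a=(1,1)\tau$, $b_0=(b_1,1)$, $b_1=(b_0,a)$. For $s\ge 2$ and $G\le \mathrm{Aut}\,T$, the $s$th Basilica group of $G$ is $\mathrm{Bas}_s(G)=\langle \beta_i^s(g)\mid g\in G,\ 0\le i\le s-1\rangle$, where the monomorphisms $\beta_i^s:\mathrm{Aut}\,T\to\mathrm{Aut}\,T$ are defined recursively by $\beta_i^s(g)=(\beta_{i-1}^s(g),1)$ for $1\le i\le s-1$ and $\beta_0^s(g)=(\beta_{s-1}^s(g|_0),\beta_{s-1}^s(g|_1))\,g|^\epsilon$. Explicitly, $B=\mathrm{Bas}_2(G)$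 is generated by $a=(1,1)\tau$, $\alpha=(a,1)$, $c_0=(c_1,1)$, $c_1=(c_2,1)$, $c_2=(c_3,1)$, $c_3=(c_0,\alpha)$. *)

theory Defs
  imports "HOL-Algebra.Algebra"
begin

text \<open>
  The letters 0 and 1 are \<^term>\<open>False\<close> and \<^term>\<open>True\<close>, and the vertices of the binary rooted
  tree are the finite words over them. Automorphisms act on the left, so the product of g and h
  in the automorphism group is \<^term>\<open>g \<circ> h\<close>.
\<close>

type_synonym vertex = "bool list"

definition tree_adj :: "vertex \<Rightarrow> vertex \<Rightarrow> bool" where
  "tree_adj u v \<longleftrightarrow> (\<exists>x. v = u @ [x] \<or> u = v @ [x])"

definition AutT :: "(vertex \<Rightarrow> vertex) monoid" where
  "AutT = \<lparr>carrier = {g. bij g \<and> g [] = [] \<and> (\<forall>u v. tree_adj (g u) (g v) \<longleftrightarrow> tree_adj u v)},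
           monoid.mult = (\<circ>), one = id\<rparr>"

text \<open>
  The section of g at v, characterised for tree automorphisms by the lemmas
  \<open>section_spec\<close> and \<open>section_unique\<close> below.
\<close>

definition sect :: "(vertex \<Rightarrow> vertex) \<Rightarrow> vertex \<Rightarrow> (vertex \<Rightarrow> vertex)" where
  "sect g v = (\<lambda>w. drop (length v) (g (v @ w)))"

text \<open>
  The automorphism with sections x and y at 0 and 1, acting on the first level by s; in the usual
  notation, (x, y) s.
\<close>

fun wreath :: "(vertex \<Rightarrow> vertex) \<Rightarrow> (vertex \<Rightarrow> vertex) \<Rightarrow> (bool \<Rightarrow> bool) \<Rightarrow> vertex \<Rightarrow> vertex" where
  "wreath x y s [] = []"
| "wreath x y s (False # w) = s False # x w"
| "wreath x y s (True # w) = s True # y w"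

definition gen_a :: "vertex \<Rightarrow> vertex" where
  "gen_a = wreath id id Not"

text \<open>
  The equations for \<open>b\<^sub>0\<close> and \<open>b\<^sub>1\<close> are unfolded on words, since they refer to each
  other; they are recovered as \<open>gen_b0_wreath\<close> and \<open>gen_b1_wreath\<close>.
\<close>

fun gen_b0 :: "vertex \<Rightarrow> vertex" and gen_b1 :: "vertex \<Rightarrow> vertex" where
  "gen_b0 [] = []"
| "gen_b0 (False # w) = False # gen_b1 w"
| "gen_b0 (True # w) = True # w"
| "gen_b1 [] = []"
| "gen_b1 (False # w) = False # gen_b0 w"
| "gen_b1 (True # w) = True # gen_a w"

definition grigorchuk_erschler :: "(vertex \<Rightarrow> vertex) set" where
  "grigorchuk_erschler = generate AutT {gen_a, gen_b0, gen_b1}"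

definition first_level :: "(vertex \<Rightarrow> vertex) \<Rightarrow> bool \<Rightarrow> bool" where
  "first_level g x = hd (g [x])"

text \<open>
  \<open>basilica_map s i g\<close> is \<open>\<beta>\<^sub>i\<^sup>s(g)\<close>, again unfolded on words; the wreath
  form of the recursion is \<open>basilica_map_Suc\<close> and \<open>basilica_map_0\<close>. Only indices
  i < s are used.
\<close>

fun basilica_map :: "nat \<Rightarrow> nat \<Rightarrow> (vertex \<Rightarrow> vertex) \<Rightarrow> vertex \<Rightarrow> vertex" where
  "basilica_map s i g [] = []"
| "basilica_map s 0 g (x # w) = first_level g x # basilica_map s (s - 1) (sect g [x]) w"
| "basilica_map s (Suc i) g (False # w) = False # basilica_map s i g w"
| "basilica_map s (Suc i) g (True # w) = True # w"

definition Bas :: "nat \<Rightarrow> (vertex \<Rightarrow> vertex) set \<Rightarrow> (vertex \<Rightarrow> vertex) set" where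
  "Bas s G = generate AutT {basilica_map s i g | i g. g \<in> G \<and> i < s}"

definition Bas_group :: "nat \<Rightarrow> (vertex \<Rightarrow> vertex) set \<Rightarrow> (vertex \<Rightarrow> vertex) monoid" where
  "Bas_group s G = AutT\<lparr>carrier := Bas s G\<rparr>"

definition maximal_subgroup :: "'a set \<Rightarrow> ('a, 'b) monoid_scheme \<Rightarrow> bool" where
  "maximal_subgroup M G \<longleftrightarrow> subgroup M G \<and> M \<noteq> carrier G \<and>
     (\<forall>K. subgroup K G \<and> M \<subseteq> K \<longrightarrow> K = M \<or> K = carrier G)"


lemma gen_b0_wreath: "gen_b0 = wreath gen_b1 id id"
proof
  fix w show "gen_b0 w = wreath gen_b1 id id w"
    by (cases "(gen_b1, id :: vertex \<Rightarrow> vertex, id :: bool \<Rightarrow> bool, w)" rule: wreath.cases) auto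
qed

lemma gen_b1_wreath: "gen_b1 = wreath gen_b0 gen_a id"
proof
  fix w show "gen_b1 w = wreath gen_b0 gen_a id w"
    by (cases "(gen_b0, gen_a, id :: bool \<Rightarrow> bool, w)" rule: wreath.cases) auto
qed

lemma basilica_map_Suc: "basilica_map s (Suc i) g = wreath (basilica_map s i g) id id"
proof
  fix w show "basilica_map s (Suc i) g w = wreath (basilica_map s i g) id id w"
    by (cases "(gen_b0, gen_a, id :: bool \<Rightarrow> bool, w)" rule: wreath.cases) auto
qed

lemma basilica_map_0:
  "basilica_map s 0 g =
     wreath (basilica_map s (s - 1) (sect g [False])) (basilica_map s (s - 1) (sect g [True]))
       (first_level g)"
proof
  fix w show "basilica_map s 0 g w =
     wreath (basilica_map s (s - 1) (sect g [False])) (basilica_map s (s - 1) (sect g [True]))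
       (first_level g) w"
    by (cases "(gen_b0, gen_a, id :: bool \<Rightarrow> bool, w)" rule: wreath.cases) auto
qed

lemma Aut_adj: "g \<in> carrier AutT \<Longrightarrow> tree_adj (g u) (g v) \<longleftrightarrow> tree_adj u v"
  by (simp add: AutT_def)

lemma Aut_child:
  assumes g: "g \<in> carrier AutT"
  shows "\<exists>y. g (u @ [x]) = g u @ [y]"
proof (induction u arbitrary: x rule: rev_induct)
  case Nil
  have "tree_adj [] [x]" by (simp add: tree_adj_def)
  then have "tree_adj (g []) (g [x])" using Aut_adj[OF g] by simp
  moreover have e: "g [] = []" using g by (simp add: AutT_def)
  ultimately have "tree_adj [] (g [x])" by simp
  then show ?case by (simp add: tree_adj_def e)
next
  case (snoc z u)
  have adj: "tree_adj (g (u @ [z])) (g (u @ [z] @ [x]))"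
  proof -
    have "tree_adj (u @ [z]) (u @ [z] @ [x])" by (simp add: tree_adj_def)
    then show ?thesis using Aut_adj[OF g] by simp
  qed
  obtain y where y: "g (u @ [z]) = g u @ [y]" using snoc.IH by blast
  have "g (u @ [z] @ [x]) \<noteq> g u"
    using g by (auto simp: AutT_def bij_def inj_eq)
  then show ?case using adj y by (auto simp: tree_adj_def)
qed

lemma Aut_length:
  assumes g: "g \<in> carrier AutT"
  shows "length (g v) = length v"
proof (induction v rule: rev_induct)
  case Nil show ?case using g by (auto simp: AutT_def)
next
  case (snoc x v) then show ?case using Aut_child[OF g, of v x] by auto
qed

lemma section_spec:
  assumes g: "g \<in> carrier AutT"
  shows "g (v @ w) = g v @ sect g v w"
proof -
  have "\<exists>z. g (v @ w) = g v @ z"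
  proof (induction w rule: rev_induct)
    case Nil show ?case by simp
  next
    case (snoc x w) then show ?case using Aut_child[OF g, of "v @ w" x] by auto
  qed
  then show ?thesis using Aut_length[OF g, of v] by (auto simp: sect_def)
qed

lemma section_unique:
  assumes g: "g \<in> carrier AutT" and "\<And>w. g (v @ w) = g v @ h w"
  shows "h = sect g v"
  using assms(2) section_spec[OF g, of v] by (intro ext) (metis same_append_eq)

lemma AutI:
  assumes b: "bij g" and e: "g [] = []" and c: "\<And>u x. \<exists>y. g (u @ [x]) = g u @ [y]"
  shows "g \<in> carrier AutT"
proof -
  have 1: "tree_adj (g u) (g v)" if "tree_adj u v" for u v
    using that c unfolding tree_adj_def by metis
  have 2: "\<exists>z. v = u @ [z]" if "g v = g u @ [x]" for u v x
  proof (cases v rule: rev_cases)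
    case Nil then show ?thesis using that e by simp
  next
    case (snoc p z)
    then have "g p = g u" using c[of p z] that by auto
    then show ?thesis using snoc b by (simp add: bij_def inj_eq)
  qed
  have "tree_adj (g u) (g v) \<longleftrightarrow> tree_adj u v" for u v
    using 1 2 unfolding tree_adj_def by metis
  then show ?thesis using b e by (simp add: AutT_def)
qed

lemma group_AutT: "group AutT"
proof (rule groupI)
  fix g h assume "g \<in> carrier AutT" "h \<in> carrier AutT"
  then show "g \<otimes>\<^bsub>AutT\<^esub> h \<in> carrier AutT"
    by (auto simp: AutT_def intro: bij_comp)
next
  show "\<one>\<^bsub>AutT\<^esub> \<in> carrier AutT" by (simp add: AutT_def)
next
  fix g assume g: "g \<in> carrier AutT"
  then have b: "bij g" by (simp add: AutT_def)
  have "inv_into UNIV g [] = []"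
    using g b by (metis (mono_tags, lifting) AutT_def bij_inv_eq_iff mem_Collect_eq partial_object.select_convs(1))
  moreover have "tree_adj (inv_into UNIV g u) (inv_into UNIV g v) \<longleftrightarrow> tree_adj u v" for u v
  proof -
    have "tree_adj (g (inv_into UNIV g u)) (g (inv_into UNIV g v))
      \<longleftrightarrow> tree_adj (inv_into UNIV g u) (inv_into UNIV g v)"
      using g by (simp add: AutT_def)
    then show ?thesis using b by (simp add: bij_is_surj surj_f_inv_f)
  qed
  ultimately have "inv_into UNIV g \<in> carrier AutT"
    using b by (simp add: AutT_def bij_imp_bij_inv)
  moreover have "inv_into UNIV g \<otimes>\<^bsub>AutT\<^esub> g = \<one>\<^bsub>AutT\<^esub>"
    using b by (simp add: AutT_def bij_is_inj)
  ultimately show "\<exists>h\<in>carrier AutT. h \<otimes>\<^bsub>AutT\<^esub> g = \<one>\<^bsub>AutT\<^esub>" by blast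
qed (auto simp: AutT_def)

text \<open>
  A length-preserving, injective map compatible with prefixes is an automorphism; used to
  place the recursively defined maps in \<^term>\<open>AutT\<close>.
\<close>

lemma AutI_inj:
  assumes i: "inj g" and l: "\<And>v. length (g v) = length v"
    and c: "\<And>u x. \<exists>y. g (u @ [x]) = g u @ [y]"
  shows "g \<in> carrier AutT"
proof (rule AutI)
  have "v \<in> range g" for v
  proof -
    let ?S = "{w :: vertex. length w = length v}"
    have f: "finite ?S" using finite_lists_length_eq[of "UNIV :: bool set" "length v"] by simp
    have "g ` ?S \<subseteq> ?S" using l by auto
    then have "g ` ?S = ?S" using f i by (meson endo_inj_surj inj_on_subset subset_UNIV)
    then show ?thesis by blast
  qed
  then show "bij g" using i by (auto simp: bij_def)
  show "g [] = []" using l[of "[]"] by simp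
qed (rule c)

lemma section_Aut:
  assumes g: "g \<in> carrier AutT"
  shows "sect g v \<in> carrier AutT"
proof (rule AutI_inj)
  have "inj g" using g by (simp add: AutT_def bij_def)
  then show "inj (sect g v)"
    unfolding inj_def using section_spec[OF g, of v] by (metis append_same_eq same_append_eq)
  show "length (sect g v w) = length w" for w using Aut_length[OF g] by (simp add: sect_def)
  show "\<exists>y. sect g v (u @ [x]) = sect g v u @ [y]" for u x
    using Aut_child[OF g, of "v @ u" x] section_spec[OF g, of v] by auto
qed

lemma wreath_Aut:
  assumes x: "x \<in> carrier AutT" and y: "y \<in> carrier AutT" and s: "bij s"
  shows "wreath x y s \<in> carrier AutT"
proof (rule AutI_inj)
  have W: "wreath x y s (c # w) = s c # (if c then y w else x w)" for c w by (cases c) auto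
  have ix: "inj x" and iy: "inj y" and js: "inj s" using x y s by (auto simp: AutT_def bij_def)
  show "inj (wreath x y s)"
  proof (rule injI)
    fix u v assume "wreath x y s u = wreath x y s v"
    then show "u = v" using ix iy js
      by (cases u; cases v) (auto simp: W inj_eq split: if_splits)
  qed
  show "length (wreath x y s v) = length v" for v
    by (cases v) (auto simp: W Aut_length[OF x] Aut_length[OF y])
  show "\<exists>z. wreath x y s (u @ [c]) = wreath x y s u @ [z]" for u c
    using Aut_child[OF x, of "tl u" c] Aut_child[OF y, of "tl u" c] Aut_length[OF x, of "[]"]
      Aut_length[OF y, of "[]"]
    by (cases u) (auto simp: W)
qed

lemma first_level_bij:
  assumes g: "g \<in> carrier AutT"
  shows "bij (first_level g)"
proof -
  have s: "g [x] = [first_level g x]" for x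
    using Aut_length[OF g, of "[x]"] by (cases "g [x]") (auto simp: first_level_def)
  have "inj g" using g by (simp add: AutT_def bij_def)
  then have "inj (first_level g)" by (metis s injI inj_eq list.inject)
  then show ?thesis by (simp add: bij_def finite_UNIV_inj_surj)
qed

lemma Aut_wreath:
  assumes g: "g \<in> carrier AutT"
  shows "g = wreath (sect g [False]) (sect g [True]) (first_level g)"
proof
  fix w
  have s: "g [x] = [first_level g x]" for x
    using Aut_length[OF g, of "[x]"] by (cases "g [x]") (auto simp: first_level_def)
  have "g (x # u) = first_level g x # sect g [x] u" for x u
    using section_spec[OF g, of "[x]" u] s by simp
  then show "g w = wreath (sect g [False]) (sect g [True]) (first_level g) w"
    using Aut_length[OF g, of "[]"]
    by (cases "(gen_b0, gen_a, id :: bool \<Rightarrow> bool, w)" rule: wreath.cases) auto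
qed

lemma id_Aut: "id \<in> carrier AutT" by (simp add: AutT_def)

lemma gen_a_Aut: "gen_a \<in> carrier AutT"
  unfolding gen_a_def by (intro wreath_Aut id_Aut) (auto intro!: bijI injI)

lemma gen_b_inj: "inj gen_b0" "inj gen_b1"
proof -
  have a: "gen_a u = gen_a v \<longleftrightarrow> u = v" for u v
    using gen_a_Aut by (simp add: AutT_def bij_def inj_eq)
  have "(\<forall>v. gen_b0 u = gen_b0 v \<longrightarrow> u = v)" "(\<forall>v. gen_b1 u = gen_b1 v \<longrightarrow> u = v)" for u
  proof (induction u and u rule: gen_b0_gen_b1.induct)
    case (2 w)
    show ?case
    proof (intro allI impI)
      fix v assume "gen_b0 (False # w) = gen_b0 v"
      then show "False # w = v" using 2 by (cases v rule: gen_b0.cases) auto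
    qed
  next
    case (5 w)
    show ?case
    proof (intro allI impI)
      fix v assume "gen_b1 (False # w) = gen_b1 v"
      then show "False # w = v" using 5 by (cases v rule: gen_b0.cases) auto
    qed
  next
    case 1 show ?case by (intro allI impI, case_tac v rule: gen_b0.cases) auto
  next
    case 3 show ?case by (intro allI impI, case_tac v rule: gen_b0.cases) auto
  next
    case 4 show ?case by (intro allI impI, case_tac v rule: gen_b0.cases) auto
  next
    case 6 show ?case by (intro allI impI, case_tac v rule: gen_b0.cases) (auto simp: a)
  qed
  then show "inj gen_b0" "inj gen_b1" unfolding inj_def by blast+
qed

lemma gen_b_Aut: "gen_b0 \<in> carrier AutT" "gen_b1 \<in> carrier AutT"
proof -
  have l: "length (gen_b0 v) = length v" "length (gen_b1 v) = length v" for v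
    by (induction v and v rule: gen_b0_gen_b1.induct) (auto simp: Aut_length[OF gen_a_Aut])
  have c: "\<exists>y. gen_b0 (u @ [x]) = gen_b0 u @ [y]" "\<exists>y. gen_b1 (u @ [x]) = gen_b1 u @ [y]" for u x
  proof (induction u and u rule: gen_b0_gen_b1.induct)
    case 1 show ?case by (cases x) auto
  next
    case 4 show ?case by (cases x) (auto simp: gen_a_def)
  next
    case (6 w) show ?case using Aut_child[OF gen_a_Aut, of w x] by auto
  qed auto
  show "gen_b0 \<in> carrier AutT" "gen_b1 \<in> carrier AutT"
    by (rule AutI_inj; simp add: gen_b_inj l c)+
qed

lemma basilica_map_Aut:
  assumes g: "g \<in> carrier AutT"
  shows "basilica_map s i g \<in> carrier AutT"
proof (rule AutI_inj)
  show "length (basilica_map s i g v) = length v" for v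
    by (induction s i g v rule: basilica_map.induct) auto
  show "\<exists>y. basilica_map s i g (u @ [x]) = basilica_map s i g u @ [y]" for u x
  proof (induction s i g u rule: basilica_map.induct)
    case (1 s i g) show ?case by (cases i; cases x) auto
  qed auto
  have "\<forall>v. basilica_map s i g u = basilica_map s i g v \<longrightarrow> u = v" for u
    using g
  proof (induction s i g u rule: basilica_map.induct)
    case (1 s i g)
    show ?case
    proof (intro allI impI)
      fix v assume "basilica_map s i g [] = basilica_map s i g v"
      then show "[] = v" by (cases "(s, i, g, v)" rule: basilica_map.cases) auto
    qed
  next
    case (2 s g x w)
    show ?case
    proof (intro allI impI)
      fix v assume e: "basilica_map s 0 g (x # w) = basilica_map s 0 g v"
      obtain y z where v: "v = y # z" using e by (cases v) auto
      have "x = y" using e v first_level_bij[OF 2(2)] by (auto simp: bij_def inj_eq)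
      then show "x # w = v" using e v 2(1) section_Aut[OF 2(2)] by auto
    qed
  next
    case (3 s i g w)
    show ?case
    proof (intro allI impI)
      fix v assume "basilica_map s (Suc i) g (False # w) = basilica_map s (Suc i) g v"
      then show "False # w = v" using 3 by (cases v rule: gen_b0.cases) auto
    qed
  next
    case (4 s i g w)
    show ?case
    proof (intro allI impI)
      fix v assume "basilica_map s (Suc i) g (True # w) = basilica_map s (Suc i) g v"
      then show "True # w = v" by (cases v rule: gen_b0.cases) auto
    qed
  qed
  then show "inj (basilica_map s i g)" unfolding inj_def by blast
qed

lemma subgroup_grigorchuk_erschler: "subgroup grigorchuk_erschler AutT"
  unfolding grigorchuk_erschler_def
  using gen_a_Aut gen_b_Aut by (intro group.generate_is_subgroup group_AutT) auto

lemma subgroup_Bas: "G \<subseteq> carrier AutT \<Longrightarrow> subgroup (Bas s G) AutT"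
  unfolding Bas_def
  by (intro group.generate_is_subgroup group_AutT) (auto intro: basilica_map_Aut)

lemma group_Bas_group: "G \<subseteq> carrier AutT \<Longrightarrow> group (Bas_group s G)"
  unfolding Bas_group_def
  by (intro subgroup.subgroup_is_group subgroup_Bas group_AutT)

end

theory Submission
  imports Defs
begin

text \<open>
  Write \<open>B\<close> for the second Basilica group, \<open>d = c\<^sub>1 c\<^sub>3\<close> and \<open>t = a d\<close>. Let
  \<open>H = \<langle>a', \<alpha>, c\<^sub>0, c\<^sub>1, c\<^sub>2, c\<^sub>3\<rangle>\<close>, where \<open>a' = a d a d a\<close> is the conjugate of \<open>a\<close> by \<open>a d\<close>. Then \<open>H\<close>
  and \<open>a\<close> generate \<open>B\<close>, and \<open>t\<^sup>3 = a' d\<close> is in \<open>H\<close>. Every maximal subgroup that contains \<open>H\<close> has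
  infinite index, and there is one. This rests on two facts.

  The subgroup \<open>H\<close> is proper (\<open>gen_a_notin_twisted_basilica\<close>). There is an injective map
  \<open>\<delta>\<close> of the tree (\<open>twist\<close>) that commutes with \<open>\<alpha>\<close> and all \<open>c\<^sub>i\<close> and satisfies \<open>\<delta> a = a' \<delta>\<close>, so every
  \<open>h \<in> H\<close> has the form \<open>h \<delta> = \<delta> g\<close> with \<open>g \<in> B\<close>. If \<open>a\<close> were in \<open>H\<close>, the corresponding \<open>g\<close> would be an
  element of \<open>B\<close> that is its own section at the vertex 1010, hence at arbitrarily deep vertices.
  But \<open>B\<close> is contracting: deep sections of an element of \<open>B\<close> belong to the nucleus
  \<open>{a, \<alpha>} \<union> \<langle>c\<^sub>0, c\<^sub>1, c\<^sub>2, c\<^sub>3\<rangle>\<close> (\<open>basilica_contracting\<close>). Looking at the first letter, \<open>g\<close> would have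
  to be \<open>a\<close>, which does not commute with \<open>\<delta>\<close>.

  Every non-trivial normal subgroup \<open>N\<close> of \<open>B\<close> contains a power \<open>t\<^bsup>2\<^sup>k\<^esup>\<close>
  (\<open>normal_contains_transl_power\<close>). Indeed \<open>B\<close> is weakly branch over its commutator subgroup
  \<open>B'\<close>: a copy of \<open>B'\<close> acting below any single vertex lies in \<open>B'\<close> again. If an element of \<open>N\<close> moves a
  vertex, taking commutators with two such copies shows that \<open>N\<close> contains a copy of \<open>B''\<close> below that
  vertex, and by transitivity below each vertex of its level. The section of \<open>t\<^sup>2\<close> at 00 is \<open>t\<close>, the
  section at 10 is \<open>t\<^sup>-\<^sup>1\<close>, and the other two are trivial, so a high 2-power of \<open>t\<close> is a product of
  copies of fixed powers of \<open>t\<^sup>\<plusminus>\<^sup>1\<close> placed deep in the tree, and these are in \<open>N\<close>.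

  Now choose \<open>M \<supseteq> H\<close> maximal with \<open>a \<notin> M\<close>; it is a maximal subgroup. If its index were finite,
  its normal core would be non-trivial, because \<open>B\<close> is infinite, and \<open>M\<close> would contain some
  \<open>t\<^bsup>2\<^sup>k\<^esup>\<close> as well as \<open>t\<^sup>3\<close>. Then \<open>t\<close> and \<open>a = t d\<close> would be in \<open>M\<close>.
\<close>

section \<open>Subgroups\<close>

context group
begin

lemma inv_cancel_left [simp]:
  assumes "x \<in> carrier G" "y \<in> carrier G"
  shows "x \<otimes> (inv x \<otimes> y) = y" "inv x \<otimes> (x \<otimes> y) = y"
  using assms by (simp_all flip: m_assoc)

text \<open>
  The elements whose commutator with \<open>y\<close> lies in \<open>N\<close> are closed under products and inverses,
  because \<open>[g h, y] = g [h, y] g\<^sup>-\<^sup>1 [g, y]\<close>.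
\<close>

lemma commutators_with_generated:
  assumes T: "T \<subseteq> carrier G" and N: "subgroup N G" and y: "y \<in> carrier G"
    and conj: "\<And>g x. g \<in> generate G T \<Longrightarrow> x \<in> N \<Longrightarrow> g \<otimes> x \<otimes> inv g \<in> N"
    and comm: "\<And>s. s \<in> T \<Longrightarrow> s \<otimes> y \<otimes> inv s \<otimes> inv y \<in> N"
    and x: "x \<in> generate G T"
  shows "x \<otimes> y \<otimes> inv x \<otimes> inv y \<in> N"
  using x
proof (induction rule: generate.induct)
  case one
  then show ?case using y N by (simp add: subgroup.one_closed)
next
  case (incl h)
  then show ?case by (rule comm)
next
  case (inv h)
  then have h: "h \<in> carrier G" "inv h \<in> generate G T" using T by (auto intro: generate.inv)
  have "inv h \<otimes> inv (h \<otimes> y \<otimes> inv h \<otimes> inv y) \<otimes> inv (inv h) \<in> N"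
    using conj[OF h(2)] comm[OF inv] N by (simp add: subgroup.m_inv_closed)
  then show ?case using h y by (simp add: m_assoc inv_mult_group)
next
  case (eng g h)
  then have c: "g \<in> carrier G" "h \<in> carrier G" using T generate_in_carrier by auto
  have "(g \<otimes> (h \<otimes> y \<otimes> inv h \<otimes> inv y) \<otimes> inv g) \<otimes> (g \<otimes> y \<otimes> inv g \<otimes> inv y) \<in> N"
    using conj[OF eng(1)] eng N by (simp add: subgroup.m_closed)
  then show ?case using c y by (simp add: m_assoc inv_mult_group)
qed

text \<open>
  The quotient of \<open>\<langle>T\<rangle>\<close> by a normal subgroup is abelian as soon as the images of the
  generators commute.
\<close>

lemma derived_generate_subset:
  assumes T: "T \<subseteq> carrier G" and N: "subgroup N G"
    and conj: "\<And>g x. g \<in> generate G T \<Longrightarrow> x \<in> N \<Longrightarrow> g \<otimes> x \<otimes> inv g \<in> N"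
    and comm: "\<And>s t. s \<in> T \<Longrightarrow> t \<in> T \<Longrightarrow> s \<otimes> t \<otimes> inv s \<otimes> inv t \<in> N"
  shows "derived G (generate G T) \<subseteq> N"
proof -
  have sym: "y \<otimes> x \<otimes> inv y \<otimes> inv x \<in> N"
    if "x \<otimes> y \<otimes> inv x \<otimes> inv y \<in> N" "x \<in> carrier G" "y \<in> carrier G" for x y
    using subgroup.m_inv_closed[OF N that(1)] that(2,3) by (simp add: m_assoc inv_mult_group)
  have 1: "x \<otimes> t \<otimes> inv x \<otimes> inv t \<in> N" if "x \<in> generate G T" "t \<in> T" for x t
    by (rule commutators_with_generated[OF T N _ conj comm]) (use that T in auto)
  have "x \<otimes> y \<otimes> inv x \<otimes> inv y \<in> N" if x: "x \<in> generate G T" and y: "y \<in> generate G T" for x y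
  proof (rule commutators_with_generated[OF T N _ conj _ x])
    show y': "y \<in> carrier G" using generate_in_carrier[OF T y] .
    show "s \<otimes> y \<otimes> inv s \<otimes> inv y \<in> N" if "s \<in> T" for s
      using sym[OF 1[OF y that] y'] that T by blast
  qed
  then show ?thesis
    unfolding derived_def using N by (intro generate_subgroup_incl) auto
qed

text \<open>
  By Zorn's lemma there is a subgroup that is maximal among those containing \<open>H\<close> but not \<open>x\<close>;
  it is then maximal outright.
\<close>

lemma exists_maximal_subgroup_above:
  assumes H: "subgroup H G" and x: "x \<in> carrier G" "x \<notin> H"
    and gen: "\<And>K. subgroup K G \<Longrightarrow> H \<subseteq> K \<Longrightarrow> x \<in> K \<Longrightarrow> K = carrier G"
  shows "\<exists>M. maximal_subgroup M G \<and> H \<subseteq> M"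
proof -
  let ?A = "{K. subgroup K G \<and> H \<subseteq> K \<and> x \<notin> K}"
  have "\<exists>M\<in>?A. \<forall>K\<in>?A. M \<subseteq> K \<longrightarrow> K = M"
  proof (rule subset_Zorn_nonempty)
    show "?A \<noteq> {}" using H x by blast
  next
    fix C assume C: "C \<noteq> {}" "subset.chain ?A C"
    then have sub: "C \<subseteq> ?A" and lin: "\<And>K L. K \<in> C \<Longrightarrow> L \<in> C \<Longrightarrow> K \<subseteq> L \<or> L \<subseteq> K"
      by (auto simp: subset_chain_def)
    have mult: "y \<otimes> z \<in> \<Union>C" if "y \<in> \<Union>C" "z \<in> \<Union>C" for y z
    proof -
      from that obtain K L where K: "K \<in> C" "y \<in> K" and L: "L \<in> C" "z \<in> L" by blast
      then obtain J where "J \<in> C" "y \<in> J" "z \<in> J" using lin[OF K(1) L(1)] by blast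
      then show ?thesis using sub subgroup.m_closed[of J G y z] by blast
    qed
    have "subgroup (\<Union>C) G"
    proof (rule subgroupI)
      show "\<Union>C \<subseteq> carrier G" using sub subgroup.subset[of _ G] by fast
      obtain K where "K \<in> C" using C(1) by blast
      then show "\<Union>C \<noteq> {}" using sub subgroup.one_closed[of K G] by blast
      show "inv y \<in> \<Union>C" if y: "y \<in> \<Union>C" for y
      proof -
        from y obtain K where K: "K \<in> C" "y \<in> K" by blast
        then have "inv y \<in> K" using sub subgroup.m_inv_closed[of K G y] by blast
        then show ?thesis using K by blast
      qed
    qed (rule mult)
    moreover have "H \<subseteq> \<Union>C" "x \<notin> \<Union>C" using C(1) sub by auto
    ultimately show "\<Union>C \<in> ?A" by simp
  qed
  then obtain M where "M \<in> ?A" and max: "\<forall>K\<in>?A. M \<subseteq> K \<longrightarrow> K = M" ..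
  then have M: "subgroup M G" "H \<subseteq> M" "x \<notin> M" by simp_all
  have "maximal_subgroup M G"
    unfolding maximal_subgroup_def
  proof (intro conjI allI impI)
    show "subgroup M G" "M \<noteq> carrier G" using M x by auto
    fix K assume K: "subgroup K G \<and> M \<subseteq> K"
    show "K = M \<or> K = carrier G"
    proof (cases "x \<in> K")
      case True
      moreover have "H \<subseteq> K" using K M(2) by blast
      ultimately show ?thesis using K gen[of K] by simp
    next
      case False
      then have "K \<in> ?A" using K M(2) by auto
      then show ?thesis using K max by simp
    qed
  qed
  then show ?thesis using M by blast
qed

text \<open>
  The kernel of the right action of an infinite group on finitely many cosets is infinite; the
  element found here lies in that kernel, which is the normal core of \<open>M\<close>.
\<close>

lemma finite_index_core_nontrivial:
  assumes inf: "infinite (carrier G)" and M: "subgroup M G" and fin: "finite (rcosets M)"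
  shows "\<exists>g\<in>carrier G. g \<noteq> \<one> \<and> (\<forall>x\<in>carrier G. x \<otimes> g \<otimes> inv x \<in> M)"
proof -
  define F where "F g = (\<lambda>C\<in>rcosets M. C #> g)" for g
  have "F g \<in> (rcosets M) \<rightarrow>\<^sub>E (rcosets M)" if "g \<in> carrier G" for g
    using that subgroup.subset[OF M] by (auto simp: F_def RCOSETS_def coset_mult_assoc)
  then have "finite (F ` carrier G)"
    using finite_PiE[OF fin, of "\<lambda>_. rcosets M"] fin by (meson finite_subset image_subsetI)
  then have "\<not> inj_on F (carrier G)" using inf finite_imageD by blast
  then obtain g h where gh: "g \<in> carrier G" "h \<in> carrier G" "F g = F h" "g \<noteq> h"
    unfolding inj_on_def by blast
  have "x \<otimes> (g \<otimes> inv h) \<otimes> inv x \<in> M" if x: "x \<in> carrier G" for x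
  proof -
    have "M #> x \<in> rcosets M" using x by (auto simp: RCOSETS_def)
    then have "M #> x #> g = M #> x #> h" using fun_cong[OF gh(3), of "M #> x"] by (simp add: F_def)
    then have "M #> (x \<otimes> g) = M #> (x \<otimes> h)"
      using x gh subgroup.subset[OF M] by (simp add: coset_mult_assoc)
    moreover have "x \<otimes> g \<in> M #> (x \<otimes> g)" using x gh M by (simp add: rcos_self)
    ultimately obtain m where m: "m \<in> M" "x \<otimes> g = m \<otimes> (x \<otimes> h)" by (auto simp: r_coset_def)
    then have mc: "m \<in> carrier G" using subgroup.mem_carrier[OF M] by blast
    have "x \<otimes> (g \<otimes> inv h) \<otimes> inv x = (x \<otimes> g) \<otimes> (inv h \<otimes> inv x)"
      using x gh by (simp add: m_assoc)
    also have "\<dots> = m" unfolding m(2) using x gh mc by (simp add: m_assoc)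
    finally show ?thesis using m by simp
  qed
  moreover have "g \<otimes> inv h \<noteq> \<one>"
  proof
    assume "g \<otimes> inv h = \<one>"
    then have "g \<otimes> inv h \<otimes> h = h" using gh by simp
    then show False using gh by (simp add: m_assoc)
  qed
  ultimately show ?thesis using gh(1,2) by (intro bexI[of _ "g \<otimes> inv h"]) simp_all
qed

end

section \<open>Tree automorphisms\<close>

interpretation AutT: group AutT by (rule group_AutT)

lemma mult_AutT [simp]: "g \<otimes>\<^bsub>AutT\<^esub> h = g \<circ> h"
  by (simp add: AutT_def)

lemma one_AutT [simp]: "\<one>\<^bsub>AutT\<^esub> = id"
  by (simp add: AutT_def)

abbreviation Ainv :: "(vertex \<Rightarrow> vertex) \<Rightarrow> vertex \<Rightarrow> vertex" where
  "Ainv \<equiv> m_inv AutT"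

lemma inv_AutT_apply [simp]:
  assumes "g \<in> carrier AutT"
  shows "g (Ainv g w) = w" "Ainv g (g w) = w"
  using AutT.r_inv[OF assms] AutT.l_inv[OF assms] by (simp_all add: fun_eq_iff)

lemma comp_Aut [simp]: "g \<in> carrier AutT \<Longrightarrow> h \<in> carrier AutT \<Longrightarrow> g \<circ> h \<in> carrier AutT"
  using AutT.m_closed by simp

lemma inv_AutT_unique:
  assumes "g \<in> carrier AutT" "h \<in> carrier AutT" "\<And>w. h (g w) = w"
  shows "Ainv g = h"
  using assms AutT.inv_equality[of h g] by (simp add: fun_eq_iff)

lemma inv_comp_AutT:
  "g \<in> carrier AutT \<Longrightarrow> h \<in> carrier AutT \<Longrightarrow>
     Ainv (g \<circ> h) = Ainv h \<circ> Ainv g"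
  using AutT.inv_mult_group[of g h] by simp

lemma Aut_apply_eq_iff: "g \<in> carrier AutT \<Longrightarrow> g u = g v \<longleftrightarrow> u = v"
  by (simp add: AutT_def bij_def inj_eq)

lemma Aut_Nil [simp]: "g \<in> carrier AutT \<Longrightarrow> g [] = []"
  by (simp add: AutT_def)

lemma subgroup_AutT_comp: "subgroup N AutT \<Longrightarrow> g \<in> N \<Longrightarrow> h \<in> N \<Longrightarrow> g \<circ> h \<in> N"
  using subgroup.m_closed by fastforce

lemma subgroup_AutT_id: "subgroup N AutT \<Longrightarrow> id \<in> N"
  using subgroup.one_closed by fastforce

lemma subgroup_AutT_funpow: "subgroup N AutT \<Longrightarrow> g \<in> N \<Longrightarrow> g ^^ n \<in> N"
  by (induction n) (simp_all add: subgroup_AutT_id subgroup_AutT_comp)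

lemma sect_comp:
  assumes g: "g \<in> carrier AutT" and h: "h \<in> carrier AutT"
  shows "sect (g \<circ> h) v = sect g (h v) \<circ> sect h v"
proof -
  have "(g \<circ> h) (v @ w) = (g \<circ> h) v @ (sect g (h v) \<circ> sect h v) w" for w
    by (simp add: section_spec[OF g] section_spec[OF h])
  then show ?thesis by (intro section_unique[symmetric] comp_Aut g h)
qed

lemma sect_append: "sect g (v @ w) = sect (sect g v) w" if "g \<in> carrier AutT"
  by (simp add: fun_eq_iff sect_def add.commute)

text \<open>
  An involutive generating set generates by products alone, so no inverses need be considered in
  inductions over the group.
\<close>

lemma generate_involutions_induct [consumes 1, case_names involution id gen comp]:
  assumes g: "g \<in> generate AutT S" and S: "\<And>s. s \<in> S \<Longrightarrow> s \<in> carrier AutT \<and> s \<circ> s = id"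
    and "P id" "\<And>s. s \<in> S \<Longrightarrow> P s"
    and "\<And>g h. g \<in> generate AutT S \<Longrightarrow> h \<in> generate AutT S \<Longrightarrow> P g \<Longrightarrow> P h \<Longrightarrow> P (g \<circ> h)"
  shows "P g"
  using g
proof (induction rule: generate.induct)
  case (inv h)
  then have "Ainv h = h"
    using S by (intro inv_AutT_unique) (auto simp: fun_eq_iff)
  then show ?case using assms inv by simp
next
  case one
  then show ?case unfolding one_AutT by (rule assms(3))
next
  case (eng g h)
  then show ?case unfolding mult_AutT by (intro assms(5))
qed (rule assms(4))

abbreviation pair :: "(vertex \<Rightarrow> vertex) \<Rightarrow> (vertex \<Rightarrow> vertex) \<Rightarrow> vertex \<Rightarrow> vertex" where
  "pair x y \<equiv> wreath x y id"

lemma vertex_fun_eqI: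
  assumes "f [] = g []" "\<And>w. f (False # w) = g (False # w)" "\<And>w. f (True # w) = g (True # w)"
  shows "f = (g :: vertex \<Rightarrow> 'b)"
proof
  fix w show "f w = g w" using assms by (cases w) (simp, metis (full_types))
qed

lemma pair_comp: "pair x y \<circ> pair x' y' = pair (x \<circ> x') (y \<circ> y')"
  by (rule vertex_fun_eqI) simp_all

lemma pair_id [simp]: "pair id id = id"
  by (rule vertex_fun_eqI) simp_all

lemma pair_Aut [simp]: "x \<in> carrier AutT \<Longrightarrow> y \<in> carrier AutT \<Longrightarrow> pair x y \<in> carrier AutT"
  by (simp add: wreath_Aut)

lemma inv_pair:
  assumes "x \<in> carrier AutT" "y \<in> carrier AutT"
  shows "Ainv (pair x y) = pair (Ainv x) (Ainv y)"
proof (rule inv_AutT_unique)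
  fix w show "pair (Ainv x) (Ainv y) (pair x y w) = w"
    using assms by (cases "(x, y, id :: bool \<Rightarrow> bool, w)" rule: wreath.cases) auto
qed (use assms in simp_all)

lemma gen_a_simps [simp]:
  "gen_a [] = []" "gen_a (x # w) = (\<not> x) # w" "gen_a (gen_a w) = w"
  proof -
  show "gen_a [] = []" by (simp add: gen_a_def)
  show 1: "gen_a (x # w) = (\<not> x) # w" for x w by (cases x) (simp_all add: gen_a_def)
  show "gen_a (gen_a w) = w" by (cases w) (simp_all add: 1, simp add: gen_a_def)
qed

lemma conj_a_pair: "gen_a \<circ> pair x y \<circ> gen_a = pair y x"
  by (rule vertex_fun_eqI) simp_all

section \<open>Generators of the second Basilica group\<close>

lemma apply_singleton: "g \<in> carrier AutT \<Longrightarrow> g [x] = [first_level g x]"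
  using Aut_length[of g "[x]"] by (cases "g [x]") (auto simp: first_level_def)

text \<open>
  Together with \<open>basilica_map_id\<close>: the maps \<open>\<beta>\<^sub>i\<close> are homomorphisms, so the images of the three
  generators of the Grigorchuk--Erschler group already generate its Basilica group.
\<close>

lemma basilica_map_comp:
  assumes "g \<in> carrier AutT" "h \<in> carrier AutT"
  shows "basilica_map s i (g \<circ> h) = basilica_map s i g \<circ> basilica_map s i h"
proof
  fix w
  show "basilica_map s i (g \<circ> h) w = (basilica_map s i g \<circ> basilica_map s i h) w"
    using assms
  proof (induction s i h w arbitrary: g rule: basilica_map.induct)
    case (2 s h x w)
    have hx: "h [x] = [first_level h x]" using 2(3) by (rule apply_singleton)
    then have "first_level (g \<circ> h) x = first_level g (first_level h x)"
      by (simp only: first_level_def comp_apply list.sel)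
    moreover have "sect (g \<circ> h) [x] = sect g [first_level h x] \<circ> sect h [x]"
      using 2(2,3) hx by (simp add: sect_comp)
    ultimately show ?case using 2(1)[of "sect g [first_level h x]"] 2(2,3)
      by (simp add: section_Aut comp_def)
  qed simp_all
qed

lemma basilica_map_id: "basilica_map s i id = id"
proof
  fix w show "basilica_map s i id w = id w"
  proof (induction s i "id :: vertex \<Rightarrow> vertex" w rule: basilica_map.induct)
    case (2 s x w)
    have "sect id [x] = id" by (simp add: sect_def fun_eq_iff)
    then show ?case using 2 by (simp add: first_level_def)
  qed simp_all
qed

text \<open>
  \<open>\<beta>\<^sub>1\<close> and \<open>\<beta>\<^sub>0\<close> interleave the two generators \<open>b\<^sub>0\<close>,
  \<open>b\<^sub>1\<close>; the numbering makes \<open>c\<^sub>i = (c\<^sub>i\<^sub>+\<^sub>1, 1)\<close> for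
  \<open>i < 3\<close>, and \<open>c\<^sub>3 = (c\<^sub>0, \<alpha>)\<close>.
\<close>

definition gen_alpha :: "vertex \<Rightarrow> vertex" where "gen_alpha = basilica_map 2 1 gen_a"
definition gen_c0 :: "vertex \<Rightarrow> vertex" where "gen_c0 = basilica_map 2 1 gen_b0"
definition gen_c1 :: "vertex \<Rightarrow> vertex" where "gen_c1 = basilica_map 2 0 gen_b0"
definition gen_c2 :: "vertex \<Rightarrow> vertex" where "gen_c2 = basilica_map 2 1 gen_b1"
definition gen_c3 :: "vertex \<Rightarrow> vertex" where "gen_c3 = basilica_map 2 0 gen_b1"

lemma basilica_0_fix:
  assumes "\<And>x w. g (x # w) = x # f x w"
  shows "basilica_map 2 0 g = pair (basilica_map 2 1 (f False)) (basilica_map 2 1 (f True))"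
proof -
  have "sect g [x] = f x" for x using assms by (simp add: sect_def fun_eq_iff)
  moreover have "first_level g = id" using assms by (simp add: first_level_def fun_eq_iff)
  ultimately show ?thesis by (simp add: basilica_map_0)
qed

lemma basilica_0_a: "basilica_map 2 0 gen_a = gen_a"
proof -
  have "sect gen_a [x] = id" for x by (simp add: sect_def fun_eq_iff)
  moreover have "first_level gen_a = Not" by (simp add: first_level_def fun_eq_iff)
  ultimately show ?thesis by (simp add: basilica_map_0 basilica_map_id gen_a_def)
qed

lemma gen_wreath:
  "gen_alpha = pair gen_a id" "gen_c0 = pair gen_c1 id" "gen_c1 = pair gen_c2 id"
  "gen_c2 = pair gen_c3 id" "gen_c3 = pair gen_c0 gen_alpha"
proof -
  have 1: "basilica_map 2 1 g = pair (basilica_map 2 0 g) id" for g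
    using basilica_map_Suc[of 2 0 g] by simp
  show "gen_alpha = pair gen_a id" "gen_c0 = pair gen_c1 id" "gen_c2 = pair gen_c3 id"
    by (simp_all only: gen_alpha_def gen_c0_def gen_c1_def gen_c2_def gen_c3_def 1 basilica_0_a)
  have "gen_b0 (x # w) = x # (if x then id else gen_b1) w" for x w by (cases x) simp_all
  from basilica_0_fix[of gen_b0 "\<lambda>x. if x then id else gen_b1", OF this] show "gen_c1 = pair gen_c2 id"
    by (simp add: gen_c1_def gen_c2_def basilica_map_id)
  have "gen_b1 (x # w) = x # (if x then gen_a else gen_b0) w" for x w by (cases x) simp_all
  from basilica_0_fix[of gen_b1 "\<lambda>x. if x then gen_a else gen_b0", OF this] show "gen_c3 = pair gen_c0 gen_alpha"
    by (simp add: gen_c3_def gen_c0_def gen_alpha_def)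
qed

lemma gen_alpha_simps [simp]: "gen_alpha [] = []"
  "gen_alpha (False # w) = False # gen_a w" "gen_alpha (True # w) = True # w"
  by (simp_all add: gen_wreath(1))
lemma gen_c0_simps [simp]: "gen_c0 [] = []"
  "gen_c0 (False # w) = False # gen_c1 w" "gen_c0 (True # w) = True # w"
  by (simp_all add: gen_wreath(2))
lemma gen_c1_simps [simp]: "gen_c1 [] = []"
  "gen_c1 (False # w) = False # gen_c2 w" "gen_c1 (True # w) = True # w"
  by (simp_all add: gen_wreath(3))
lemma gen_c2_simps [simp]: "gen_c2 [] = []"
  "gen_c2 (False # w) = False # gen_c3 w" "gen_c2 (True # w) = True # w"
  by (simp_all add: gen_wreath(4))
lemma gen_c3_simps [simp]: "gen_c3 [] = []"
  "gen_c3 (False # w) = False # gen_c0 w" "gen_c3 (True # w) = True # gen_alpha w"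
  by (simp_all add: gen_wreath(5))

lemma gen_alpha_involution [simp]: "gen_alpha (gen_alpha w) = w"
  by (cases w rule: gen_b0.cases) simp_all

lemma gen_c_involution [simp]:
  "gen_c0 (gen_c0 w) = w" "gen_c1 (gen_c1 w) = w" "gen_c2 (gen_c2 w) = w" "gen_c3 (gen_c3 w) = w"
proof -
  have "gen_c0 (gen_c0 w) = w \<and> gen_c1 (gen_c1 w) = w \<and> gen_c2 (gen_c2 w) = w \<and> gen_c3 (gen_c3 w) = w"
  proof (induction w)
    case (Cons x w)
    then show ?case by (cases x) simp_all
  qed simp
  then show "gen_c0 (gen_c0 w) = w" "gen_c1 (gen_c1 w) = w" "gen_c2 (gen_c2 w) = w"
    "gen_c3 (gen_c3 w) = w" by simp_all
qed

lemma gen_c_commute: "gen_c0 (gen_c2 w) = gen_c2 (gen_c0 w)" "gen_c1 (gen_c3 w) = gen_c3 (gen_c1 w)"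
proof -
  have "gen_c0 (gen_c2 w) = gen_c2 (gen_c0 w) \<and> gen_c1 (gen_c3 w) = gen_c3 (gen_c1 w)"
  proof (induction w)
    case (Cons x w)
    then show ?case by (cases x) simp_all
  qed simp
  then show "gen_c0 (gen_c2 w) = gen_c2 (gen_c0 w)" "gen_c1 (gen_c3 w) = gen_c3 (gen_c1 w)"
    by simp_all
qed

lemma gen_Aut [simp]:
  "gen_a \<in> carrier AutT" "gen_alpha \<in> carrier AutT" "gen_c0 \<in> carrier AutT"
  "gen_c1 \<in> carrier AutT" "gen_c2 \<in> carrier AutT" "gen_c3 \<in> carrier AutT"
  by (simp_all add: gen_alpha_def gen_c0_def gen_c1_def gen_c2_def gen_c3_def
      basilica_map_Aut gen_a_Aut gen_b_Aut)

definition basilica_gens :: "(vertex \<Rightarrow> vertex) set" where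
  "basilica_gens = {gen_a, gen_alpha, gen_c0, gen_c1, gen_c2, gen_c3}"

definition basilica :: "(vertex \<Rightarrow> vertex) set" where
  "basilica = generate AutT basilica_gens"

lemma basilica_gens_Aut: "basilica_gens \<subseteq> carrier AutT"
  by (simp add: basilica_gens_def)

lemma basilica_gens_involution: "s \<in> basilica_gens \<Longrightarrow> s \<in> carrier AutT \<and> s \<circ> s = id"
  by (auto simp: basilica_gens_def intro!: ext)

lemma subgroup_basilica: "subgroup basilica AutT"
  unfolding basilica_def by (rule AutT.generate_is_subgroup[OF basilica_gens_Aut])

lemma basilica_Aut: "g \<in> basilica \<Longrightarrow> g \<in> carrier AutT"
  using subgroup.mem_carrier[OF subgroup_basilica] .

lemma gen_basilica [simp]:
  "gen_a \<in> basilica" "gen_alpha \<in> basilica" "gen_c0 \<in> basilica" "gen_c1 \<in> basilica"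
  "gen_c2 \<in> basilica" "gen_c3 \<in> basilica"
  unfolding basilica_def by (rule generate.incl, simp add: basilica_gens_def)+

lemmas basilica_comp = subgroup_AutT_comp[OF subgroup_basilica]

lemma basilica_inv: "g \<in> basilica \<Longrightarrow> Ainv g \<in> basilica"
  using subgroup.m_inv_closed[OF subgroup_basilica] .

lemma basilica_induct [consumes 1, case_names id gen comp]:
  assumes g: "g \<in> basilica" and P: "P id" "\<And>s. s \<in> basilica_gens \<Longrightarrow> P s"
      "\<And>g h. g \<in> basilica \<Longrightarrow> h \<in> basilica \<Longrightarrow> P g \<Longrightarrow> P h \<Longrightarrow> P (g \<circ> h)"
  shows "P g"
  using g[unfolded basilica_def]
proof (induction rule: generate_involutions_induct)
  case (comp g h)
  then show ?case by (intro P(3)) (simp_all only: basilica_def)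
qed (rule basilica_gens_involution P(1,2), assumption?)+

lemma Bas_eq_basilica: "Bas 2 grigorchuk_erschler = basilica"
proof
  let ?E = "{gen_a, gen_b0, gen_b1}"
  have E: "?E \<subseteq> carrier AutT" using gen_b_Aut by simp
  have incl: "basilica_map 2 i g \<in> Bas 2 grigorchuk_erschler" if "g \<in> ?E" "i < 2" for g i
    unfolding Bas_def grigorchuk_erschler_def using that
    by (intro generate.incl CollectI exI[of _ i] exI[of _ g]) (auto intro: generate.incl)
  have "basilica_gens \<subseteq> Bas 2 grigorchuk_erschler"
    using incl[of gen_a 0] incl[of gen_a 1] incl[of gen_b0 0] incl[of gen_b0 1] incl[of gen_b1 0]
      incl[of gen_b1 1]
    by (simp add: basilica_gens_def gen_alpha_def gen_c0_def gen_c1_def gen_c2_def gen_c3_def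
        basilica_0_a)
  then show "basilica \<subseteq> Bas 2 grigorchuk_erschler"
    unfolding basilica_def
    using subgroup_Bas[of grigorchuk_erschler 2] subgroup.subset[OF subgroup_grigorchuk_erschler]
    by (intro AutT.generate_subgroup_incl) auto
  have "basilica_map 2 i g \<in> basilica" if g: "g \<in> grigorchuk_erschler" and i: "i < 2" for i g
  proof -
    interpret h: group_hom AutT AutT "basilica_map 2 i"
      by unfold_locales (auto simp: hom_def basilica_map_Aut basilica_map_comp)
    have "basilica_map 2 i ` ?E \<subseteq> basilica"
    proof -
      from i have "i = 0 \<or> i = 1" by auto
      then show ?thesis
        using gen_basilica[unfolded gen_alpha_def gen_c0_def gen_c1_def gen_c2_def gen_c3_def]
        by (elim disjE) (simp_all only: basilica_0_a image_insert image_empty insert_subset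
            empty_subsetI simp_thms)
    qed
    then have "generate AutT (basilica_map 2 i ` ?E) \<subseteq> basilica"
      by (rule AutT.generate_subgroup_incl[OF _ subgroup_basilica])
    then show ?thesis using g h.generate_img[OF E] by (auto simp: grigorchuk_erschler_def)
  qed
  then show "Bas 2 grigorchuk_erschler \<subseteq> basilica"
    unfolding Bas_def by (intro AutT.generate_subgroup_incl[OF _ subgroup_basilica]) auto
qed

section \<open>A subgroup conjugate to the whole group\<close>

definition gen_d :: "vertex \<Rightarrow> vertex" where "gen_d = gen_c1 \<circ> gen_c3"
definition gen_e :: "vertex \<Rightarrow> vertex" where "gen_e = gen_c0 \<circ> gen_c2"

lemma gen_d_simps [simp]: "gen_d [] = []"
  "gen_d (False # w) = False # gen_e w" "gen_d (True # w) = True # gen_alpha w"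
  by (simp_all add: gen_d_def gen_e_def gen_c_commute)

lemma gen_e_simps [simp]: "gen_e [] = []"
  "gen_e (False # w) = False # gen_d w" "gen_e (True # w) = True # w"
  by (simp_all add: gen_d_def gen_e_def)

lemma gen_d_involution [simp]: "gen_d (gen_d w) = w"
  by (simp add: gen_d_def gen_c_commute)

lemma gen_d_Aut [simp]: "gen_d \<in> carrier AutT"
  by (simp add: gen_d_def)

definition twisted_a :: "vertex \<Rightarrow> vertex" where
  "twisted_a = gen_a \<circ> gen_d \<circ> gen_a \<circ> gen_d \<circ> gen_a"

definition twisted_basilica :: "(vertex \<Rightarrow> vertex) set" where
  "twisted_basilica =
     generate AutT {twisted_a, gen_alpha, gen_c0, gen_c1, gen_c2, gen_c3}"

text \<open>
  The map \<open>\<delta>\<close>, unfolded two letters at a time because the index of \<open>\<beta>\<^sub>i\<close> has period 2. Its sections at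
  the second level are \<open>\<delta>\<close>, except for \<open>d a \<delta>\<close> at 10.
\<close>

fun twist :: "vertex \<Rightarrow> vertex" where
  "twist [] = []"
| "twist [x] = [x]"
| "twist (False # y # w) = False # y # twist w"
| "twist (True # True # w) = True # True # twist w"
| "twist (True # False # w) = True # False # gen_d (gen_a (twist w))"

text \<open>
  Conjugation by \<open>\<delta>\<close> fixes all generators except \<open>a\<close>, which it sends to \<open>a'\<close>. The recursion of \<open>\<delta>\<close> is
  forced by this: \<open>\<delta> a = a' \<delta>\<close> dictates how the sections of \<open>\<delta>\<close> at 0 and 1 differ, and the
  generator \<open>c\<^sub>3\<close>, whose section at 10 is \<open>a\<close>, is fixed because the factor \<open>d a\<close> conjugates
  \<open>a'\<close> back to \<open>a\<close>.
\<close>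

lemma twist_conj:
  "twist (gen_a w) = twisted_a (twist w)"
  "twist (gen_alpha w) = gen_alpha (twist w)"
  "twist (gen_c0 w) = gen_c0 (twist w)"
  "twist (gen_c1 w) = gen_c1 (twist w)"
  "twist (gen_c2 w) = gen_c2 (twist w)"
  "twist (gen_c3 w) = gen_c3 (twist w)"
proof -
  have "twist (gen_a w) = twisted_a (twist w) \<and> twist (gen_alpha w) = gen_alpha (twist w) \<and>
    twist (gen_c0 w) = gen_c0 (twist w) \<and> twist (gen_c1 w) = gen_c1 (twist w) \<and>
    twist (gen_c2 w) = gen_c2 (twist w) \<and> twist (gen_c3 w) = gen_c3 (twist w)"
  proof (induction w rule: twist.induct)
    case (2 x)
    then show ?case by (cases x) (simp_all add: twisted_a_def)
  next
    case (3 y w)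
    then show ?case by (cases y) (simp_all add: twisted_a_def)
  qed (simp_all add: twisted_a_def)
  then show
    "twist (gen_a w) = twisted_a (twist w)"
    "twist (gen_alpha w) = gen_alpha (twist w)"
    "twist (gen_c0 w) = gen_c0 (twist w)"
    "twist (gen_c1 w) = gen_c1 (twist w)"
    "twist (gen_c2 w) = gen_c2 (twist w)"
    "twist (gen_c3 w) = gen_c3 (twist w)" by simp_all
qed

lemma twist_inject: "twist u = twist v \<Longrightarrow> u = v"
proof (induction u arbitrary: v rule: twist.induct)
  case 1
  then show ?case by (cases v rule: twist.cases) simp_all
next
  case (2 x)
  then show ?case by (cases v rule: twist.cases) simp_all
next
  case (3 y w)
  then show ?case by (cases v rule: twist.cases) simp_all
next
  case (4 w)
  then show ?case by (cases v rule: twist.cases) simp_all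
next
  case (5 w)
  then show ?case
    by (cases v rule: twist.cases) (simp_all add: Aut_apply_eq_iff)
qed

lemma twisted_a_Aut [simp]: "twisted_a \<in> carrier AutT"
  by (simp add: twisted_a_def)

lemma twisted_a_involution: "twisted_a \<circ> twisted_a = id"
  by (simp add: twisted_a_def fun_eq_iff)

text \<open>
  \<open>H\<close> is contained in \<open>\<delta> B \<delta>\<^sup>-\<^sup>1\<close>, stated without an inverse of \<open>\<delta>\<close>.
\<close>

lemma twisted_conj:
  assumes "h \<in> twisted_basilica"
  shows "\<exists>g\<in>basilica. h \<circ> twist = twist \<circ> g"
  using assms unfolding twisted_basilica_def
proof (induction rule: generate_involutions_induct)
  case id
  then show ?case by (intro bexI[of _ id] subgroup_AutT_id subgroup_basilica) simp
next
  case (gen s)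
  moreover have "twisted_a \<circ> twist = twist \<circ> gen_a" "gen_alpha \<circ> twist = twist \<circ> gen_alpha"
    "gen_c0 \<circ> twist = twist \<circ> gen_c0" "gen_c1 \<circ> twist = twist \<circ> gen_c1"
    "gen_c2 \<circ> twist = twist \<circ> gen_c2" "gen_c3 \<circ> twist = twist \<circ> gen_c3"
    by (simp_all add: fun_eq_iff twist_conj)
  ultimately show ?case using gen_basilica by blast
next
  case (comp g h)
  then obtain g' h' where g': "g' \<in> basilica" "g \<circ> twist = twist \<circ> g'"
    and h': "h' \<in> basilica" "h \<circ> twist = twist \<circ> h'" by blast
  then have "(g \<circ> h) \<circ> twist = twist \<circ> (g' \<circ> h')" by (simp add: fun_eq_iff)
  then show ?case using basilica_comp[OF g'(1) h'(1)] by blast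
next
  case (involution s)
  then show ?case using twisted_a_involution by (auto intro!: ext)
qed

section \<open>Contraction\<close>

definition c_group :: "(vertex \<Rightarrow> vertex) set" where
  "c_group = generate AutT {gen_c0, gen_c1, gen_c2, gen_c3}"

text \<open>
  The generators \<open>c\<^sub>i\<close> have to be completed to the finite group generated by them, as a product of
  \<open>c\<^sub>i\<close>s has again a product of \<open>c\<^sub>i\<close>s as its section at 0.
\<close>

definition nucleus :: "(vertex \<Rightarrow> vertex) set" where
  "nucleus = {gen_a, gen_alpha} \<union> c_group"

lemma subgroup_c_group: "subgroup c_group AutT"
  unfolding c_group_def by (rule AutT.generate_is_subgroup) simp

lemma sect_pair [simp]: "sect (pair x y) [False] = x" "sect (pair x y) [True] = y"
  by (simp_all add: sect_def)

lemma sect_gen_a [simp]: "sect gen_a [x] = id"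
  by (simp add: sect_def fun_eq_iff)

lemma c_group_pair:
  assumes "c \<in> c_group"
  shows "\<exists>c'\<in>c_group. \<exists>x\<in>{id, gen_alpha}. c = pair c' x"
  using assms unfolding c_group_def
proof (induction rule: generate_involutions_induct)
  case id
  have "id \<in> generate AutT {gen_c0, gen_c1, gen_c2, gen_c3}"
    using subgroup_AutT_id[OF subgroup_c_group] by (simp only: c_group_def)
  then show ?case using pair_id[symmetric] by blast
next
  case (gen s)
  then consider "s = pair gen_c0 gen_alpha" | "s = pair gen_c1 id" | "s = pair gen_c2 id" | "s = pair gen_c3 id"
    using gen_wreath(2-5) by blast
  moreover have "s \<in> generate AutT {gen_c0, gen_c1, gen_c2, gen_c3}"
    if "s \<in> {gen_c0, gen_c1, gen_c2, gen_c3}" for s using that by (rule generate.incl)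
  ultimately show ?case by cases blast+
next
  case (comp g h)
  then obtain g' x h' y where g': "g' \<in> c_group" "x \<in> {id, gen_alpha}" "g = pair g' x"
    and h': "h' \<in> c_group" "y \<in> {id, gen_alpha}" "h = pair h' y"
    unfolding c_group_def by blast
  have "x \<circ> y \<in> {id, gen_alpha}"
    using g'(2) h'(2) by (auto intro!: ext)
  moreover have "g \<circ> h = pair (g' \<circ> h') (x \<circ> y)" using g' h' by (simp add: pair_comp)
  ultimately show ?case
    using subgroup_AutT_comp[OF subgroup_c_group g'(1) h'(1)] unfolding c_group_def by blast
next
  case (involution s)
  then show ?case by (auto intro!: ext)
qed

lemma sect_nucleus:
  assumes "g \<in> nucleus"
  shows "sect g v \<in> nucleus"
  using assms
proof (induction v arbitrary: g)
  case Nil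
  then show ?case by (simp add: sect_def)
next
  case (Cons x v)
  have 1: "id \<in> nucleus" using subgroup_AutT_id[OF subgroup_c_group] by (simp add: nucleus_def)
  have "g \<in> carrier AutT"
    using Cons.prems subgroup.mem_carrier[OF subgroup_c_group] by (auto simp: nucleus_def)
  then have "sect g (x # v) = sect (sect g [x]) v" using sect_append[of g "[x]" v] by simp
  moreover have "sect g [x] \<in> nucleus"
  proof (cases "g \<in> c_group")
    case True
    then show ?thesis using c_group_pair[OF True] 1 by (cases x) (auto simp: nucleus_def)
  next
    case False
    then have "g = gen_a \<or> g = pair gen_a id"
      using Cons.prems by (simp add: nucleus_def gen_wreath(1))
    then show ?thesis using 1 by (cases x) (auto simp: nucleus_def)
  qed
  ultimately show ?case using Cons.IH by simp
qed

lemma nucleus_Aut: "g \<in> nucleus \<Longrightarrow> g \<in> carrier AutT"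
  using subgroup.mem_carrier[OF subgroup_c_group] by (auto simp: nucleus_def)

lemma sect_nucleus_a:
  assumes "g \<in> nucleus"
  shows "sect (gen_a \<circ> g) [x] \<in> nucleus" "sect (g \<circ> gen_a) [x] \<in> nucleus"
  using sect_nucleus[OF assms] nucleus_Aut[OF assms] apply_singleton[of g x]
  by (simp_all add: sect_comp)

text \<open>
  Two levels suffice: the only products leaving the nucleus at once are those with \<open>a\<close>, whose
  sections are sections of the other factor, and those with \<open>\<alpha> = (a, 1)\<close>, whose section at 0 is a
  product with \<open>a\<close>.
\<close>

lemma sect_nucleus_comp:
  assumes g: "g \<in> nucleus" and h: "h \<in> nucleus" and v: "length v = 2"
  shows "sect (g \<circ> h) v \<in> nucleus"
proof -
  obtain x y where v: "v = [x, y]" using v by (auto simp: length_Suc_conv numeral_2_eq_2)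
  have split: "sect (g \<circ> h) v = sect (sect (g \<circ> h) [x]) [y]"
    using sect_append[of "g \<circ> h" "[x]" "[y]"] nucleus_Aut g h v by simp
  show ?thesis
  proof (cases "g = gen_a \<or> h = gen_a")
    case True
    then show ?thesis using sect_nucleus_a g h unfolding split by (metis sect_nucleus)
  next
    case False
    have pair: "\<exists>c\<in>nucleus. \<exists>x\<in>{id, gen_alpha}. k = pair c x \<and> (c = gen_a \<or> c \<in> c_group)"
      if "k \<in> nucleus" "k \<noteq> gen_a" for k
      using that c_group_pair[of k] by (auto simp: nucleus_def gen_wreath(1))
    obtain c p where c: "c \<in> nucleus" "p \<in> {id, gen_alpha}" "g = pair c p" "c = gen_a \<or> c \<in> c_group"
      using pair[OF g] False by blast
    obtain d q where d: "d \<in> nucleus" "q \<in> {id, gen_alpha}" "h = pair d q" "d = gen_a \<or> d \<in> c_group"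
      using pair[OF h] False by blast
    have gh: "g \<circ> h = pair (c \<circ> d) (p \<circ> q)" using c d by (simp add: pair_comp)
    have 1: "sect (c \<circ> d) [y] \<in> nucleus"
    proof (cases "c = gen_a \<or> d = gen_a")
      case True
      then show ?thesis using sect_nucleus_a c(1) d(1) by metis
    next
      case False
      then have "c \<circ> d \<in> c_group" using c d subgroup_AutT_comp[OF subgroup_c_group] by blast
      then show ?thesis by (intro sect_nucleus) (simp add: nucleus_def)
    qed
    have "p \<circ> q \<in> {id, gen_alpha}" using c(2) d(2) by (auto intro!: ext)
    then have "p \<circ> q \<in> nucleus"
      using subgroup_AutT_id[OF subgroup_c_group] by (auto simp: nucleus_def)
    then have "sect (sect (pair (c \<circ> d) (p \<circ> q)) [x]) [y] \<in> nucleus"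
      using 1 sect_nucleus[of "p \<circ> q" "[y]"] by (cases x) (simp_all only: sect_pair)
    then show ?thesis using split gh by simp
  qed
qed

text \<open>
  A product of two elements with nuclear sections at depth \<open>k\<close> has nuclear sections at depth
  \<open>k + 2\<close>, so the property passes from the generators to all of \<open>B\<close>.
\<close>

lemma basilica_contracting:
  assumes "g \<in> basilica"
  shows "\<exists>n. \<forall>v. n \<le> length v \<longrightarrow> sect g v \<in> nucleus"
  using assms
proof (induction rule: basilica_induct)
  case id
  have "id \<in> nucleus" using subgroup_AutT_id[OF subgroup_c_group] by (simp add: nucleus_def)
  then show ?case using sect_nucleus by blast
next
  case (gen s)
  then have "s \<in> nucleus"
    by (auto simp: basilica_gens_def nucleus_def c_group_def intro: generate.incl)
  then show ?case using sect_nucleus by blast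
next
  case (comp g h)
  then obtain m n where m: "\<And>v. m \<le> length v \<Longrightarrow> sect g v \<in> nucleus"
    and n: "\<And>v. n \<le> length v \<Longrightarrow> sect h v \<in> nucleus" by blast
  have g: "g \<in> carrier AutT" and h: "h \<in> carrier AutT" using comp basilica_Aut by blast+
  have "sect (g \<circ> h) v \<in> nucleus" if v: "max m n + 2 \<le> length v" for v
  proof -
    define k where "k = length v - 2"
    have k: "length (take k v) = k" "length (drop k v) = 2" "m \<le> k" "n \<le> k"
      using v by (auto simp: k_def)
    have "sect (g \<circ> h) v = sect (sect (g \<circ> h) (take k v)) (drop k v)"
      using sect_append[of "g \<circ> h" "take k v" "drop k v"] g h by simp
    also have "\<dots> = sect (sect g (h (take k v)) \<circ> sect h (take k v)) (drop k v)"
      using sect_comp[OF g h] by simp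
    also have "\<dots> \<in> nucleus"
      using k by (intro sect_nucleus_comp m n) (simp_all add: Aut_length[OF h])
    finally show ?thesis .
  qed
  then show ?case by blast
qed

text \<open>
  If \<open>a \<delta> = \<delta> g\<close>, then \<open>g d\<close> is a cube root of \<open>t\<close>, as \<open>\<delta>\<close> conjugates \<open>t\<close> to \<open>a' d = t\<^sup>3\<close>. Such an
  element is too complicated for \<open>B\<close>: its sections do not get simpler with depth, since \<open>g (1010 w) = 0000 g w\<close>.
  The reason is that the two corrections \<open>d a\<close> that \<open>\<delta>\<close> inserts along 1010 cancel.
\<close>

lemma gen_a_notin_twisted_basilica: "gen_a \<notin> twisted_basilica"
proof
  assume "gen_a \<in> twisted_basilica"
  then obtain g where g: "g \<in> basilica" and "gen_a \<circ> twist = twist \<circ> g"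
    using twisted_conj by blast
  then have conj: "twist (g w) = gen_a (twist w)" for w by (metis comp_apply)
  have gA: "g \<in> carrier AutT" using g by (rule basilica_Aut)
  let ?v = "[True, False, True, False]"
  \<comment> \<open>Both sides are \<open>0000\<close> followed by \<open>a (\<delta> w)\<close>.\<close>
  have "twist (g (?v @ w)) = twist ([False, False, False, False] @ g w)" for w
    by (simp add: conj)
  then have "g (?v @ w) = [False, False, False, False] @ g w" for w
    by (rule twist_inject)
  then have self: "sect g ?v = g" by (simp add: sect_def fun_eq_iff)
  have iter: "sect g (concat (replicate k ?v)) = g" for k
  proof (induction k)
    case 0
    then show ?case by (simp add: sect_def)
  next
    case (Suc k)
    then show ?case using sect_append[OF gA, of ?v "concat (replicate k ?v)"] self by simp
  qed
  obtain n where n: "\<And>v. n \<le> length v \<Longrightarrow> sect g v \<in> nucleus"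
    using basilica_contracting[OF g] by blast
  have "n \<le> length (concat (replicate n ?v))" by (simp add: length_concat sum_list_replicate)
  from n[OF this] have "g \<in> nucleus" using iter by simp
  moreover have "g [False] \<noteq> [False]" using conj[of "[False]"] by auto
  moreover have "g [False] = [False]" if "g \<in> c_group"
    using c_group_pair[OF that] subgroup.mem_carrier[OF subgroup_c_group] by auto
  ultimately have "g = gen_a" by (auto simp: nucleus_def)
  then show False using conj[of "[False, False, False]"] by simp
qed

section \<open>Branching over the commutator subgroup\<close>

abbreviation comm :: "(vertex \<Rightarrow> vertex) \<Rightarrow> (vertex \<Rightarrow> vertex) \<Rightarrow> vertex \<Rightarrow> vertex" where
  "comm x y \<equiv> x \<circ> y \<circ> Ainv x \<circ> Ainv y"

lemma comm_pair:
  assumes "x \<in> carrier AutT" "y \<in> carrier AutT" "x' \<in> carrier AutT" "y' \<in> carrier AutT"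
  shows "comm (pair x y) (pair x' y') = pair (comm x x') (comm y y')"
  using assms by (simp only: inv_pair pair_comp)

lemma comm_id: "x \<in> carrier AutT \<Longrightarrow> comm x id = id" "x \<in> carrier AutT \<Longrightarrow> comm id x = id"
  using inv_AutT_unique[of id id] by (auto simp: id_Aut intro!: ext)

lemma Ainv_gens [simp]:
  "Ainv gen_a = gen_a" "Ainv gen_alpha = gen_alpha" "Ainv gen_c0 = gen_c0"
  by (rule inv_AutT_unique; simp)+

definition basilica' :: "(vertex \<Rightarrow> vertex) set" where
  "basilica' = derived AutT basilica"

lemma subgroup_basilica': "subgroup basilica' AutT"
  unfolding basilica'_def
  by (rule AutT.derived_is_subgroup[OF subgroup.subset[OF subgroup_basilica]])

lemma basilica'_subset: "basilica' \<subseteq> basilica"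
  unfolding basilica'_def by (rule AutT.derived_incl[OF order_refl subgroup_basilica])

lemma basilica'_Aut: "g \<in> basilica' \<Longrightarrow> g \<in> carrier AutT"
  using basilica'_subset basilica_Aut by blast

lemma comm_basilica':
  assumes "x \<in> basilica" "y \<in> basilica"
  shows "comm x y \<in> basilica'"
  unfolding basilica'_def derived_def using assms by (intro generate.incl) auto

lemma conj_basilica':
  assumes g: "g \<in> basilica" and x: "x \<in> basilica'"
  shows "g \<circ> x \<circ> Ainv g \<in> basilica'"
proof -
  have "comm g x \<circ> x \<in> basilica'"
    using comm_basilica'[OF g] x basilica'_subset subgroup_AutT_comp[OF subgroup_basilica'] by blast
  moreover have "comm g x \<circ> x = g \<circ> x \<circ> Ainv g" using basilica'_Aut[OF x] by (simp add: fun_eq_iff)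
  ultimately show ?thesis by simp
qed

text \<open>
  The stabiliser of the first level projects onto \<open>B\<close> in the first coordinate. The generator
  \<open>\<alpha>\<close> is reached as the section of \<open>a c\<^sub>3 a = (\<alpha>, c\<^sub>0)\<close>, all the others as sections of generators.
\<close>

lemma basilica_lift:
  assumes "g \<in> basilica"
  shows "\<exists>k\<in>carrier AutT. pair g k \<in> basilica"
  using assms
proof (induction rule: basilica_induct)
  case id
  show ?case using subgroup_AutT_id[OF subgroup_basilica] id_Aut pair_id by metis
next
  case (gen s)
  have "pair gen_alpha gen_c0 = gen_a \<circ> gen_c3 \<circ> gen_a"
    by (simp only: gen_wreath(5) conj_a_pair)
  then have alpha: "pair gen_alpha gen_c0 \<in> basilica"
    using basilica_comp gen_basilica by metis
  have others: "pair gen_a id \<in> basilica" "pair gen_c0 gen_alpha \<in> basilica" "pair gen_c1 id \<in> basilica"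
    "pair gen_c2 id \<in> basilica" "pair gen_c3 id \<in> basilica"
    by (simp_all only: gen_wreath[symmetric] gen_basilica)
  from gen show ?case
    unfolding basilica_gens_def using alpha others gen_Aut id_Aut by blast
next
  case (comp g h)
  then obtain k l where k: "k \<in> carrier AutT" "pair g k \<in> basilica"
    and l: "l \<in> carrier AutT" "pair h l \<in> basilica" by blast
  then have "pair (g \<circ> h) (k \<circ> l) \<in> basilica" using basilica_comp[OF k(2) l(2)] by (simp only: pair_comp)
  then show ?case using comp_Aut[OF k(1) l(1)] by blast
qed

lemma basilica_sect:
  assumes "g \<in> basilica"
  shows "sect g v \<in> basilica"
  using assms
proof (induction v arbitrary: g)
  case Nil
  then show ?case by (simp add: sect_def)
next
  case (Cons x v)
  have "sect g [x] \<in> basilica" for x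
    using Cons.prems
  proof (induction arbitrary: x rule: basilica_induct)
    case id
    have "sect id [x] = id" by (simp add: sect_def fun_eq_iff)
    then show ?case using subgroup_AutT_id[OF subgroup_basilica] by (simp only:)
  next
    case (gen s)
    have id: "id \<in> basilica" by (rule subgroup_AutT_id[OF subgroup_basilica])
    have "sect gen_a [x] \<in> basilica" using id by (simp only: sect_gen_a)
    moreover have "sect gen_alpha [x] \<in> basilica" unfolding gen_wreath(1)
      by (cases x) (simp_all only: sect_pair id gen_basilica)
    moreover have "sect gen_c0 [x] \<in> basilica" unfolding gen_wreath(2)
      by (cases x) (simp_all only: sect_pair id gen_basilica)
    moreover have "sect gen_c1 [x] \<in> basilica" unfolding gen_wreath(3)
      by (cases x) (simp_all only: sect_pair id gen_basilica)
    moreover have "sect gen_c2 [x] \<in> basilica" unfolding gen_wreath(4)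
      by (cases x) (simp_all only: sect_pair id gen_basilica)
    moreover have "sect gen_c3 [x] \<in> basilica" unfolding gen_wreath(5)
      by (cases x) (simp_all only: sect_pair id gen_basilica)
    ultimately show ?case using gen unfolding basilica_gens_def by blast
  next
    case (comp g h)
    then have A: "g \<in> carrier AutT" "h \<in> carrier AutT" using basilica_Aut by blast+
    have "sect (g \<circ> h) [x] = sect g [first_level h x] \<circ> sect h [x]"
      using sect_comp[OF A, of "[x]"] apply_singleton[OF A(2), of x] by simp
    then show ?case using basilica_comp[OF comp.IH] by (simp only:)
  qed
  then show ?case
    using Cons.IH[of "sect g [x]"] sect_append[of g "[x]" v] basilica_Aut[OF Cons.prems] by simp
qed

text \<open>
  \<open>B\<close> branches over \<open>B'\<close>. The elements \<open>x\<close> with \<open>(x, 1) \<in> B'\<close> form a normal subgroup of \<open>B\<close>, so only the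
  commutators of generators matter. If \<open>s\<close> is one of \<open>a, c\<^sub>1, c\<^sub>2, c\<^sub>3\<close>, then \<open>(s, 1)\<close> is itself a
  generator, and \<open>([s, t], 1)\<close> is a commutator of it with a lift of \<open>t\<close>. The remaining commutator
  \<open>[\<alpha>, c\<^sub>0]\<close> equals \<open>[[a, \<alpha>], c\<^sub>0]\<close>, and \<open>([a, \<alpha>], 1)\<close> has just been seen to be in \<open>B'\<close>.
\<close>

lemma pair_basilica':
  assumes "x \<in> basilica'"
  shows "pair x id \<in> basilica'"
proof -
  define W where "W = {x \<in> basilica. pair x id \<in> basilica'}"
  have id: "id \<in> carrier AutT" by (rule id_Aut)
  have W: "subgroup W AutT"
  proof (rule AutT.subgroupI)
    show "W \<subseteq> carrier AutT" using basilica_Aut by (auto simp: W_def)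
    show "W \<noteq> {}"
      using subgroup_AutT_id[OF subgroup_basilica] subgroup_AutT_id[OF subgroup_basilica']
      by (auto simp: W_def intro!: exI[of _ id])
    show "Ainv x \<in> W" if "x \<in> W" for x
    proof -
      have "Ainv (pair x id) \<in> basilica'"
        using that subgroup.m_inv_closed[OF subgroup_basilica'] by (simp add: W_def)
      then show ?thesis
        using that basilica_Aut basilica_inv inv_pair[OF _ id, of x] AutT.inv_one by (simp add: W_def)
    qed
    show "x \<otimes>\<^bsub>AutT\<^esub> y \<in> W" if "x \<in> W" "y \<in> W" for x y
    proof -
      have "pair x id \<circ> pair y id \<in> basilica'"
        using that subgroup_AutT_comp[OF subgroup_basilica'] by (simp add: W_def)
      then show ?thesis using that basilica_comp unfolding pair_comp mult_AutT by (simp add: W_def)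
    qed
  qed
  have conj: "g \<otimes>\<^bsub>AutT\<^esub> x \<otimes>\<^bsub>AutT\<^esub> Ainv g \<in> W" if g: "g \<in> basilica" and x: "x \<in> W" for g x
  proof -
    obtain k where k: "k \<in> carrier AutT" "pair g k \<in> basilica" using basilica_lift[OF g] by blast
    have "pair g k \<circ> pair x id \<circ> Ainv (pair g k) \<in> basilica'"
      using x by (intro conj_basilica' k) (simp add: W_def)
    moreover have "pair g k \<circ> pair x id \<circ> Ainv (pair g k) = pair (g \<circ> x \<circ> Ainv g) (k \<circ> id \<circ> Ainv k)"
      using basilica_Aut[OF g] k by (simp only: inv_pair pair_comp)
    moreover have "k \<circ> id \<circ> Ainv k = id" using k by (simp add: fun_eq_iff)
    moreover have "g \<circ> x \<circ> Ainv g \<in> basilica"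
      using g x basilica_comp basilica_inv by (simp add: W_def)
    ultimately show ?thesis by (simp add: W_def)
  qed
  have inv: "y \<circ> x \<circ> Ainv y \<circ> Ainv x \<in> W" if "comm x y \<in> W" "x \<in> basilica" "y \<in> basilica" for x y
  proof -
    have c: "x \<in> carrier AutT" "y \<in> carrier AutT" using that basilica_Aut by blast+
    have "Ainv (comm x y) = comm y x"
      by (rule inv_AutT_unique) (use c in simp_all)
    then show ?thesis using subgroup.m_inv_closed[OF W that(1)] by simp
  qed
  have strong: "comm s t \<in> W" if s: "s \<in> {gen_a, gen_c1, gen_c2, gen_c3}" and t: "t \<in> basilica" for s t
  proof -
    have sB: "s \<in> basilica" "pair s id \<in> basilica"
      using s gen_basilica[unfolded gen_wreath(1)] gen_basilica[unfolded gen_wreath(2)]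
        gen_basilica[unfolded gen_wreath(3)] gen_basilica[unfolded gen_wreath(4)] by auto
    obtain k where k: "k \<in> carrier AutT" "pair t k \<in> basilica" using basilica_lift[OF t] by blast
    have "comm (pair s id) (pair t k) = pair (comm s t) id"
      using comm_pair[of s id t k] comm_id[of k] k id basilica_Aut sB t by simp
    then have "pair (comm s t) id \<in> basilica'" using comm_basilica'[OF sB(2) k(2)] by simp
    moreover have "comm s t \<in> basilica" using comm_basilica'[OF sB(1) t] basilica'_subset by blast
    ultimately show ?thesis by (simp add: W_def)
  qed
  \<comment> \<open>Neither \<open>(\<alpha>, 1)\<close> nor \<open>(c\<^sub>0, 1)\<close> is a generator, so this case needs its own argument.\<close>
  have weak: "comm gen_alpha gen_c0 \<in> W"
  proof -
    let ?k = "comm gen_a gen_alpha"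
    have k: "?k \<in> W" by (rule strong) simp_all
    have "comm (pair ?k id) gen_c3 \<in> basilica'"
      using k basilica'_subset by (intro comm_basilica') (auto simp: W_def)
    moreover have "comm (pair ?k id) gen_c3 = pair (comm ?k gen_c0) id"
      unfolding gen_wreath(5) using comm_pair[of ?k id gen_c0 gen_alpha] comm_id[of gen_alpha] id by simp
    moreover have "comm ?k gen_c0 = comm gen_alpha gen_c0"
      by (rule vertex_fun_eqI) (simp_all add: AutT.inv_mult_group inv_comp_AutT)
    moreover have "comm gen_alpha gen_c0 \<in> basilica"
      using comm_basilica'[of gen_alpha gen_c0] basilica'_subset by auto
    ultimately show ?thesis by (simp add: W_def)
  qed
  have same: "comm s s \<in> W" if "s \<in> basilica_gens" for s
  proof -
    have "comm s s = id" using that basilica_gens_Aut by (intro ext) auto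
    then show ?thesis using subgroup_AutT_id[OF W] by simp
  qed
  have "comm s t \<in> W" if s: "s \<in> basilica_gens" and t: "t \<in> basilica_gens" for s t
  proof -
    have B: "s \<in> basilica" "t \<in> basilica"
      using s t by (auto simp: basilica_def intro: generate.incl)
    consider "s \<in> {gen_a, gen_c1, gen_c2, gen_c3}" | "t \<in> {gen_a, gen_c1, gen_c2, gen_c3}"
      | "s = t" | "s = gen_alpha" "t = gen_c0" | "s = gen_c0" "t = gen_alpha"
      using s t unfolding basilica_gens_def by blast
    then show ?thesis
    proof cases
      case 1
      then show ?thesis using strong B by blast
    next
      case 2
      then show ?thesis using inv[OF strong] B by blast
    next
      case 3
      then show ?thesis using same s by blast
    next
      case 4
      then show ?thesis using weak by (simp only:)
    next
      case 5
      then show ?thesis using inv[OF weak] by (simp only: gen_basilica)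
    qed
  qed
  then have "basilica' \<subseteq> W"
    unfolding basilica'_def basilica_def
    by (intro AutT.derived_generate_subset basilica_gens_Aut W) (use conj in \<open>auto simp: basilica_def\<close>)
  then show ?thesis using assms by (auto simp: W_def)
qed

section \<open>Automorphisms supported below a vertex\<close>

definition at_vertex :: "vertex \<Rightarrow> (vertex \<Rightarrow> vertex) \<Rightarrow> vertex \<Rightarrow> vertex" where
  "at_vertex v x u = (if take (length v) u = v then v @ x (drop (length v) u) else u)"

lemma at_vertex_append [simp]: "at_vertex v x (v @ w) = v @ x w"
  by (simp add: at_vertex_def)

lemma at_vertex_outside: "take (length v) u \<noteq> v \<Longrightarrow> at_vertex v x u = u"
  by (simp add: at_vertex_def)

lemma at_vertex_Nil [simp]: "at_vertex [] x = x"
  by (simp add: at_vertex_def fun_eq_iff)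

lemma at_vertex_Cons:
  "at_vertex (False # v) x = pair (at_vertex v x) id"
  "at_vertex (True # v) x = pair id (at_vertex v x)"
  by (rule vertex_fun_eqI; simp add: at_vertex_def)+

lemma at_vertex_comp: "at_vertex v (x \<circ> y) = at_vertex v x \<circ> at_vertex v y"
  by (simp add: at_vertex_def fun_eq_iff)

lemma at_vertex_id: "at_vertex v id = id"
  by (auto simp: at_vertex_def fun_eq_iff) (metis append_take_drop_id)

lemma at_vertex_at_vertex: "at_vertex v (at_vertex w x) = at_vertex (v @ w) x"
proof (induction v)
  case (Cons b v)
  then show ?case by (cases b) (simp_all add: at_vertex_Cons)
qed simp

lemma at_vertex_Aut [simp]: "x \<in> carrier AutT \<Longrightarrow> at_vertex v x \<in> carrier AutT"
proof (induction v)
  case (Cons b v)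
  then show ?case by (cases b) (simp_all add: at_vertex_Cons id_Aut)
qed simp

lemma Ainv_at_vertex: "x \<in> carrier AutT \<Longrightarrow> Ainv (at_vertex v x) = at_vertex v (Ainv x)"
  by (rule inv_AutT_unique) (auto simp: at_vertex_def, metis append_take_drop_id)

lemma at_vertex_comm:
  "x \<in> carrier AutT \<Longrightarrow> y \<in> carrier AutT \<Longrightarrow>
     at_vertex v (comm x y) = comm (at_vertex v x) (at_vertex v y)"
  by (simp only: at_vertex_comp Ainv_at_vertex)

lemma at_vertex_commute:
  assumes "length v = length v'" "v \<noteq> v'"
  shows "at_vertex v x \<circ> at_vertex v' y = at_vertex v' y \<circ> at_vertex v x"
  using assms by (auto simp: at_vertex_def fun_eq_iff)

lemma Aut_take: "h \<in> carrier AutT \<Longrightarrow> take n (h u) = h (take n u)"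
  using section_spec[of h "take n u" "drop n u"] Aut_length[of h "take n u"] Aut_length[of h u]
  by (cases "n \<le> length u") simp_all

text \<open>
  Conjugation by \<open>h\<close> moves the support from below \<open>v\<close> to below \<open>h v\<close> and changes the automorphism by
  the section of \<open>h\<close>.
\<close>

lemma conj_at_vertex:
  assumes h: "h \<in> carrier AutT" and x: "x \<in> carrier AutT"
  shows "h \<circ> at_vertex v x \<circ> Ainv h = at_vertex (h v) (sect h v \<circ> x \<circ> Ainv (sect h v))"
proof
  fix u
  let ?w = "Ainv h u"
  have u: "u = h ?w" using h by simp
  show "(h \<circ> at_vertex v x \<circ> Ainv h) u = at_vertex (h v) (sect h v \<circ> x \<circ> Ainv (sect h v)) u"
  proof (cases "take (length v) ?w = v")
    case True
    then obtain z where z: "?w = v @ z" by (metis append_take_drop_id)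
    have "u = h v @ sect h v z" using u z section_spec[OF h] by simp
    then show ?thesis using z section_spec[OF h] section_Aut[OF h] by simp
  next
    case False
    then have "take (length (h v)) u \<noteq> h v"
      using Aut_take[OF h, of "length v" ?w] u Aut_length[OF h, of v] Aut_apply_eq_iff[OF h] by simp
    then show ?thesis using False u by (simp add: at_vertex_outside)
  qed
qed

lemma subgroup_at_vertex_vimage:
  assumes N: "subgroup N AutT"
  shows "subgroup {x \<in> carrier AutT. at_vertex v x \<in> N} AutT"
proof (rule AutT.subgroupI)
  show "{x \<in> carrier AutT. at_vertex v x \<in> N} \<noteq> {}"
    using id_Aut at_vertex_id[of v] subgroup_AutT_id[OF N] by (intro ex_in_conv[THEN iffD1] exI[of _ id]) simp
next
  fix x assume "x \<in> {x \<in> carrier AutT. at_vertex v x \<in> N}"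
  then show "Ainv x \<in> {x \<in> carrier AutT. at_vertex v x \<in> N}"
    using subgroup.m_inv_closed[OF N, of "at_vertex v x"] Ainv_at_vertex[of x v] by simp
next
  fix x y assume "x \<in> {x \<in> carrier AutT. at_vertex v x \<in> N}" "y \<in> {x \<in> carrier AutT. at_vertex v x \<in> N}"
  then show "x \<otimes>\<^bsub>AutT\<^esub> y \<in> {x \<in> carrier AutT. at_vertex v x \<in> N}"
    using subgroup_AutT_comp[OF N, of "at_vertex v x" "at_vertex v y"] at_vertex_comp[of v x y]
      comp_Aut[of x y] unfolding mult_AutT by simp
qed auto

section \<open>Normal subgroups\<close>

lemma at_vertex_basilica':
  assumes "x \<in> basilica'"
  shows "at_vertex v x \<in> basilica'"
proof (induction v)
  case Nil
  then show ?case using assms by simp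
next
  case (Cons b v)
  have F: "pair (at_vertex v x) id \<in> basilica'" using Cons.IH by (rule pair_basilica')
  then have "gen_a \<circ> pair (at_vertex v x) id \<circ> Ainv gen_a \<in> basilica'"
    by (intro conj_basilica') simp_all
  then have "pair id (at_vertex v x) \<in> basilica'" by (simp only: Ainv_gens conj_a_pair)
  then show ?case using F by (cases b) (simp_all only: at_vertex_Cons)
qed

lemma basilica_transitive_replicate: "\<exists>h\<in>basilica. h v = replicate (length v) False"
proof (induction v)
  case Nil
  show ?case using subgroup_AutT_id[OF subgroup_basilica] by (intro bexI[of _ id]) simp_all
next
  case (Cons b v)
  then obtain h k where h: "h v = replicate (length v) False" and hk: "pair h k \<in> basilica"
    using basilica_lift by blast
  show ?case
  proof (cases b)
    case True
    then have "(pair h k \<circ> gen_a) (b # v) = replicate (length (b # v)) False" using h by simp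
    then show ?thesis using basilica_comp[OF hk gen_basilica(1)] by blast
  next
    case False
    then have "pair h k (b # v) = replicate (length (b # v)) False" using h by simp
    then show ?thesis using hk by blast
  qed
qed

lemma basilica_transitive:
  assumes "length v = length w"
  shows "\<exists>h\<in>basilica. h v = w"
proof -
  obtain g h where g: "g \<in> basilica" "g v = replicate (length v) False"
    and h: "h \<in> basilica" "h w = replicate (length w) False"
    using basilica_transitive_replicate by blast
  have "Ainv h (g v) = Ainv h (h w)" using g(2) h(2) assms by (simp only:)
  then have "(Ainv h \<circ> g) v = w" using inv_AutT_apply(2)[OF basilica_Aut[OF h(1)]] by simp
  then show ?thesis by (rule bexI[OF _ basilica_comp[OF basilica_inv[OF h(1)] g(1)]])
qed

text \<open>
  By transitivity the orbit of a vertex of level \<open>n\<close> has \<open>2\<^sup>n\<close> elements.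
\<close>

lemma infinite_basilica: "infinite basilica"
proof
  assume fin: "finite basilica"
  define n where "n = card basilica"
  let ?L = "{v :: vertex. set v \<subseteq> UNIV \<and> length v = n}"
  have "?L \<subseteq> (\<lambda>h. h (replicate n False)) ` basilica"
  proof
    fix v assume "v \<in> ?L"
    then obtain h where "h \<in> basilica" "h (replicate n False) = v"
      using basilica_transitive[of "replicate n False" v] by auto
    then show "v \<in> (\<lambda>h. h (replicate n False)) ` basilica" by (intro image_eqI) simp_all
  qed
  then have "card ?L \<le> n" using surj_card_le[OF fin] by (simp add: n_def)
  then have "2 ^ n \<le> n" using card_lists_length_eq[of "UNIV :: bool set" n] by simp
  then show False using less_exp[of n] by simp
qed

text \<open>
  Let \<open>g \<in> N\<close> move \<open>v\<close>, and put \<open>x\<close> and \<open>y\<close> below \<open>v\<close>. Then \<open>[x, g]\<close> is \<open>x\<close> times a conjugate of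
  \<open>x\<^sup>-\<^sup>1\<close> supported below \<open>g v\<close>, which commutes with everything below \<open>v\<close>; hence
  \<open>[[x, g], y] = [x, y]\<close>, and the left-hand side is in \<open>N\<close>. Transitivity of \<open>B\<close> on the level carries
  the conclusion to the other vertices.
\<close>

lemma normal_contains_at_vertex:
  assumes N: "subgroup N AutT"
    and normal: "\<And>g x. g \<in> basilica \<Longrightarrow> x \<in> N \<Longrightarrow> g \<circ> x \<circ> Ainv g \<in> N"
    and g: "g \<in> N" and v: "g v \<noteq> v" and w: "length w = length v"
    and x: "x \<in> basilica'" and y: "y \<in> basilica'"
  shows "at_vertex w (comm x y) \<in> N"
proof -
  have gA: "g \<in> carrier AutT" using g subgroup.mem_carrier[OF N] by blast
  have moved: "at_vertex v (comm x y) \<in> N" if x: "x \<in> basilica'" and y: "y \<in> basilica'" for x y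
  proof -
    let ?x = "at_vertex v x" and ?y = "at_vertex v y"
    have A: "x \<in> carrier AutT" "y \<in> carrier AutT" using x y basilica'_Aut by blast+
    have B: "?x \<in> basilica" "?y \<in> basilica"
      using x y at_vertex_basilica' basilica'_subset by blast+
    define t where "t = g \<circ> Ainv ?x \<circ> Ainv g"
    have tA: "t \<in> carrier AutT" using gA A by (simp add: t_def AutT.inv_closed)
    have "t = at_vertex (g v) (sect g v \<circ> Ainv x \<circ> Ainv (sect g v))"
      using conj_at_vertex[OF gA, of "Ainv x" v] A by (simp only: t_def Ainv_at_vertex AutT.inv_closed)
    then have ty: "t \<circ> ?y = ?y \<circ> t"
      using at_vertex_commute[OF Aut_length[OF gA] v] by (simp only:)
    have xg: "?x \<circ> t \<in> N"
    proof -
      have "(?x \<circ> g \<circ> Ainv ?x) \<circ> Ainv g \<in> N"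
        by (intro subgroup_AutT_comp[OF N] normal[OF B(1)] subgroup.m_inv_closed[OF N] g)
      moreover have "(?x \<circ> g \<circ> Ainv ?x) \<circ> Ainv g = ?x \<circ> t" by (simp add: t_def comp_assoc)
      ultimately show ?thesis by (simp only:)
    qed
    have "(?x \<circ> t) \<circ> (?y \<circ> Ainv (?x \<circ> t) \<circ> Ainv ?y) \<in> N"
      by (intro subgroup_AutT_comp[OF N] normal[OF B(2)] subgroup.m_inv_closed[OF N] xg)
    moreover have "(?x \<circ> t) \<circ> (?y \<circ> Ainv (?x \<circ> t) \<circ> Ainv ?y) = comm ?x ?y"
    proof
      fix u
      have ty: "t (?y z) = ?y (t z)" for z using ty by (simp add: fun_eq_iff)
      show "((?x \<circ> t) \<circ> (?y \<circ> Ainv (?x \<circ> t) \<circ> Ainv ?y)) u = comm ?x ?y u"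
        using A tA by (simp add: ty inv_comp_AutT)
    qed
    ultimately show ?thesis using at_vertex_comm[OF A, of v] by (simp only:)
  qed
  obtain h where h: "h \<in> basilica" "h v = w" using basilica_transitive w by metis
  define k where "k = sect h v"
  have k: "k \<in> basilica" unfolding k_def using h(1) by (rule basilica_sect)
  have A: "x \<in> carrier AutT" "y \<in> carrier AutT" "k \<in> carrier AutT"
    using x y k basilica'_Aut basilica_Aut by blast+
  have kA: "Ainv k \<in> carrier AutT" "Ainv (Ainv k) = k" using A by simp_all
  let ?x = "Ainv k \<circ> x \<circ> k" and ?y = "Ainv k \<circ> y \<circ> k"
  have "?x \<in> basilica'" "?y \<in> basilica'"
    using conj_basilica'[OF basilica_inv[OF k] x] conj_basilica'[OF basilica_inv[OF k] y]
    by (simp_all only: kA)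
  then have "h \<circ> at_vertex v (comm ?x ?y) \<circ> Ainv h \<in> N" by (intro normal h moved)
  moreover have "comm ?x ?y \<in> carrier AutT" using A by (simp add: AutT.inv_closed)
  then have "h \<circ> at_vertex v (comm ?x ?y) \<circ> Ainv h = at_vertex w (k \<circ> comm ?x ?y \<circ> Ainv k)"
    using conj_at_vertex[OF basilica_Aut[OF h(1)]] h(2) by (simp only: k_def)
  moreover have "k \<circ> comm ?x ?y \<circ> Ainv k = comm x y"
    using A kA by (intro ext) (simp add: inv_comp_AutT)
  ultimately show ?thesis by (simp only:)
qed

section \<open>Powers of the translation\<close>

definition transl :: "vertex \<Rightarrow> vertex" where "transl = gen_a \<circ> gen_d"
definition transl_inv :: "vertex \<Rightarrow> vertex" where "transl_inv = gen_d \<circ> gen_a"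

lemma transl_square:
  "transl ^^ 2 = pair (pair transl id) (pair transl_inv id)"
  "transl_inv ^^ 2 = pair (pair transl_inv id) (pair transl id)"
proof -
  have "transl (transl (b # w)) = pair (pair transl id) (pair transl_inv id) (b # w)"
    "transl_inv (transl_inv (b # w)) = pair (pair transl_inv id) (pair transl id) (b # w)" for b w
    by (cases b; cases w rule: gen_b0.cases; simp add: transl_def transl_inv_def)+
  moreover have "transl [] = []" "transl_inv [] = []" by (simp_all add: transl_def transl_inv_def)
  ultimately show "transl ^^ 2 = pair (pair transl id) (pair transl_inv id)"
    "transl_inv ^^ 2 = pair (pair transl_inv id) (pair transl id)"
    by (auto simp only: numeral_2_eq_2 funpow.simps comp_id comp_apply wreath.simps intro!: vertex_fun_eqI)
qed

lemma pair_funpow: "pair x y ^^ n = pair (x ^^ n) (y ^^ n)"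
proof (induction n)
  case 0
  show ?case by (simp only: funpow.simps pair_id)
next
  case (Suc n)
  then show ?case by (simp only: funpow.simps pair_comp)
qed

lemma transl_power_double:
  "transl ^^ (2 * n) = at_vertex [False, False] (transl ^^ n) \<circ> at_vertex [True, False] (transl_inv ^^ n)"
  "transl_inv ^^ (2 * n) = at_vertex [False, False] (transl_inv ^^ n) \<circ> at_vertex [True, False] (transl ^^ n)"
  by (simp_all only: funpow_mult[symmetric] transl_square pair_funpow at_vertex_Cons at_vertex_Nil
      pair_comp comp_id id_comp id_funpow)

lemma transl_Aut: "transl \<in> carrier AutT" "transl_inv \<in> carrier AutT"
  by (simp_all add: transl_def transl_inv_def)

lemma transl_funpow_Aut: "transl ^^ n \<in> carrier AutT" "transl_inv ^^ n \<in> carrier AutT"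
  by (intro subgroup_AutT_funpow AutT.subgroup_self transl_Aut)+

lemma Ainv_transl: "Ainv transl = transl_inv" "Ainv transl_inv = transl"
  by (rule inv_AutT_unique; simp add: transl_def transl_inv_def)+

text \<open>
  Iterating \<open>transl_power_double\<close> \<open>n\<close> times writes \<open>t\<^bsup>2\<^sup>n m\<^esup>\<close> as a product of copies of
  \<open>t\<^bsup>m\<^esup>\<close> and \<open>t\<^bsup>-m\<^esup>\<close> at vertices of level \<open>2 n\<close>. The hypothesis on \<open>N\<close> passes to the subgroup of
  automorphisms whose copy below a vertex lies in \<open>N\<close>, so the induction generalises over \<open>N\<close>.
\<close>

lemma transl_power_mem:
  assumes "subgroup N AutT"
    and "\<And>w. length w = 2 * n \<Longrightarrow> at_vertex w (transl ^^ m) \<in> N \<and> at_vertex w (transl_inv ^^ m) \<in> N"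
  shows "transl ^^ (2 ^ n * m) \<in> N \<and> transl_inv ^^ (2 ^ n * m) \<in> N"
  using assms
proof (induction n arbitrary: N)
  case 0
  then show ?case using "0.prems"(2)[of "[]"] by simp
next
  case (Suc n)
  have deep: "transl ^^ (2 ^ n * m) \<in> {x \<in> carrier AutT. at_vertex v x \<in> N} \<and>
      transl_inv ^^ (2 ^ n * m) \<in> {x \<in> carrier AutT. at_vertex v x \<in> N}" if v: "length v = 2" for v
  proof (rule Suc.IH[OF subgroup_at_vertex_vimage[OF Suc.prems(1)]])
    fix w :: vertex assume "length w = 2 * n"
    then have "at_vertex (v @ w) (transl ^^ m) \<in> N" "at_vertex (v @ w) (transl_inv ^^ m) \<in> N"
      using Suc.prems(2)[of "v @ w"] v by simp_all
    then show "at_vertex w (transl ^^ m) \<in> {x \<in> carrier AutT. at_vertex v x \<in> N} \<and>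
      at_vertex w (transl_inv ^^ m) \<in> {x \<in> carrier AutT. at_vertex v x \<in> N}"
      using transl_funpow_Aut at_vertex_Aut at_vertex_at_vertex by simp
  qed
  have m: "2 ^ Suc n * m = 2 * (2 ^ n * m)" by simp
  show ?case
    unfolding m transl_power_double
    using deep[of "[False, False]"] deep[of "[True, False]"]
    by (intro conjI subgroup_AutT_comp[OF Suc.prems(1)]) simp_all
qed

text \<open>
  These identities exhibit \<open>(t\<^sup>\<plusminus>\<^sup>4, 1)\<close> as commutators of elements of \<open>B'\<close>. They rest on
  \<open>[a, \<alpha>] = (a, a)\<close> and on \<open>a\<close> inverting \<open>t\<close>, which gives \<open>[t\<^sup>2, a] = t\<^sup>4\<close>.
\<close>

lemma pow_transl_comm:
  "pair (transl ^^ 4) id = comm (pair (transl ^^ 2) id) (comm gen_a gen_alpha)"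
  "pair (transl_inv ^^ 4) id = comm (pair (transl_inv ^^ 2) id) (comm gen_a gen_alpha)"
  "transl ^^ 2 = comm gen_a gen_d" "transl_inv ^^ 2 = comm gen_d gen_a"
proof -
  have aa: "comm gen_a gen_alpha = pair gen_a gen_a"
    by (rule vertex_fun_eqI) simp_all
  have d: "Ainv gen_d = gen_d" by (rule inv_AutT_unique) simp_all
  show "transl ^^ 2 = comm gen_a gen_d" "transl_inv ^^ 2 = comm gen_d gen_a"
    by (simp_all add: numeral_2_eq_2 d fun_eq_iff transl_def transl_inv_def)
  have 1: "comm (pair x id) (pair gen_a gen_a) = pair (comm x gen_a) id" if "x \<in> carrier AutT" for x
    using that comm_id(2)[of gen_a] by (simp only: comm_pair gen_Aut id_Aut)
  have sq: "Ainv (x ^^ 2) = y ^^ 2" if "x \<in> carrier AutT" "y \<in> carrier AutT" "Ainv x = y" for x y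
    using that by (simp add: numeral_2_eq_2 inv_comp_AutT)
  have 4: "x ^^ 4 = x \<circ> x \<circ> x \<circ> x" for x :: "vertex \<Rightarrow> vertex"
    by (simp add: eval_nat_numeral comp_assoc)
  have "comm (transl ^^ 2) gen_a = transl ^^ 4" "comm (transl_inv ^^ 2) gen_a = transl_inv ^^ 4"
    unfolding 4 using sq[OF transl_Aut Ainv_transl(1)] sq[OF transl_Aut(2,1) Ainv_transl(2)]
    by (simp_all add: numeral_2_eq_2 fun_eq_iff transl_def transl_inv_def)
  then show "pair (transl ^^ 4) id = comm (pair (transl ^^ 2) id) (comm gen_a gen_alpha)"
    "pair (transl_inv ^^ 4) id = comm (pair (transl_inv ^^ 2) id) (comm gen_a gen_alpha)"
    unfolding aa 1[OF transl_funpow_Aut(1)] 1[OF transl_funpow_Aut(2)] by simp_all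
qed

lemma gen_d_basilica: "gen_d \<in> basilica"
  unfolding gen_d_def by (intro basilica_comp gen_basilica)

text \<open>
  Some level of the form \<open>2 n + 1\<close> contains a vertex moved by \<open>g\<close>. The group \<open>N\<close> contains \<open>B''\<close>
  below each vertex of that level, hence \<open>t\<^sup>\<plusminus>\<^sup>4\<close> at each vertex of level \<open>2 n + 2\<close> ending in 0, and so
  \<open>t\<^sup>\<plusminus>\<^sup>8\<close> at each vertex of level \<open>2 n\<close>, because \<open>t\<^sup>8\<close> is \<open>t\<^sup>4\<close> at 00 times \<open>t\<^sup>-\<^sup>4\<close> at 10.
\<close>

lemma normal_contains_transl_power:
  assumes N: "subgroup N AutT"
    and normal: "\<And>g x. g \<in> basilica \<Longrightarrow> x \<in> N \<Longrightarrow> g \<circ> x \<circ> Ainv g \<in> N"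
    and g: "g \<in> N" "g \<noteq> id"
  shows "\<exists>k. transl ^^ (2 ^ k) \<in> N"
proof -
  have gA: "g \<in> carrier AutT" using g subgroup.mem_carrier[OF N] by blast
  obtain u where u: "g u \<noteq> u" using g(2) by (auto simp: fun_eq_iff)
  define n where "n = length u"
  \<comment> \<open>An extension of \<open>u\<close> is moved as well; this one has the odd length that is wanted.\<close>
  define v where "v = u @ replicate (n + 1) False"
  have v: "length v = 2 * n + 1" by (simp add: v_def n_def)
  have moved: "g v \<noteq> v"
    using u section_spec[OF gA, of u] Aut_length[OF gA, of u] by (simp add: v_def)
  have aa: "comm gen_a gen_alpha \<in> basilica'" by (intro comm_basilica' gen_basilica)
  have sq: "pair (transl ^^ 2) id \<in> basilica'" "pair (transl_inv ^^ 2) id \<in> basilica'"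
    unfolding pow_transl_comm(3,4) by (intro pair_basilica' comm_basilica' gen_basilica gen_d_basilica)+
  have four: "at_vertex (w @ [False]) (transl ^^ 4) \<in> N" "at_vertex (w @ [False]) (transl_inv ^^ 4) \<in> N"
    if w: "length w = 2 * n + 1" for w
  proof -
    have "at_vertex w (comm (pair (transl ^^ 2) id) (comm gen_a gen_alpha)) \<in> N"
      "at_vertex w (comm (pair (transl_inv ^^ 2) id) (comm gen_a gen_alpha)) \<in> N"
      using w v by (intro normal_contains_at_vertex[OF N normal g(1) moved] sq aa; simp)+
    then show "at_vertex (w @ [False]) (transl ^^ 4) \<in> N" "at_vertex (w @ [False]) (transl_inv ^^ 4) \<in> N"
      unfolding pow_transl_comm(1,2)[symmetric] at_vertex_at_vertex[symmetric]
      by (simp_all only: at_vertex_Cons at_vertex_Nil)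
  qed
  have eight: "at_vertex w (transl ^^ 8) \<in> N \<and> at_vertex w (transl_inv ^^ 8) \<in> N"
    if w: "length w = 2 * n" for w
  proof -
    have 8: "8 = 2 * (4 :: nat)" by simp
    have "at_vertex (w @ [b, False]) (transl ^^ 4) \<in> N" "at_vertex (w @ [b, False]) (transl_inv ^^ 4) \<in> N"
      for b using four[of "w @ [b]"] w by simp_all
    then show ?thesis
      unfolding 8 transl_power_double at_vertex_comp at_vertex_at_vertex
      by (intro conjI subgroup_AutT_comp[OF N])
  qed
  have "transl ^^ (2 ^ n * 8) \<in> N" using transl_power_mem[OF N eight] by blast
  moreover have "2 ^ n * 8 = (2 :: nat) ^ (n + 3)" by (simp add: power_add)
  ultimately show ?thesis by (intro exI[of _ "n + 3"]) (simp only:)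
qed

lemma transl_mem_of_powers:
  assumes M: "subgroup M AutT" and 3: "transl ^^ 3 \<in> M" and 2: "transl ^^ (2 ^ k) \<in> M"
  shows "transl \<in> M"
proof -
  \<comment> \<open>\<open>2\<^sup>k\<close> is invertible modulo 3, and \<open>2 \<cdot> 2 = 3 + 1\<close> gives the inverse inductively.\<close>
  have "\<exists>i j. 2 ^ k * i = 3 * j + (1 :: nat)"
  proof (induction k)
    case 0
    have "2 ^ 0 * 1 = 3 * 0 + (1 :: nat)" by simp
    then show ?case by blast
  next
    case (Suc k)
    then obtain i j :: nat where "2 ^ k * i = 3 * j + 1" by blast
    then have "2 ^ Suc k * (2 * i) = 3 * (4 * j + 1) + 1" by simp
    then show ?case by blast
  qed
  then obtain i j :: nat where ij: "2 ^ k * i = Suc (3 * j)" by auto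
  let ?p = "transl ^^ (3 * j)"
  have "?p = (transl ^^ 3) ^^ j" by (simp only: funpow_mult)
  then have p: "?p \<in> M" using subgroup_AutT_funpow[OF M 3] by (simp only:)
  have "(transl ^^ (2 ^ k)) ^^ i = transl \<circ> ?p" by (simp only: funpow_mult ij funpow.simps)
  then have "transl \<circ> ?p \<in> M" using subgroup_AutT_funpow[OF M 2, of i] by (simp only:)
  then have "(transl \<circ> ?p) \<circ> Ainv ?p \<in> M"
    using subgroup.m_inv_closed[OF M p] by (rule subgroup_AutT_comp[OF M])
  moreover have "(transl \<circ> ?p) \<circ> Ainv ?p = transl"
    by (rule ext) (simp only: comp_apply inv_AutT_apply(1)[OF transl_funpow_Aut(1)])
  ultimately show ?thesis by (simp only:)
qed

section \<open>The maximal subgroup\<close>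

lemma twisted_gens_mem:
  "twisted_a \<in> twisted_basilica" "gen_alpha \<in> twisted_basilica" "gen_c0 \<in> twisted_basilica"
  "gen_c1 \<in> twisted_basilica" "gen_c2 \<in> twisted_basilica" "gen_c3 \<in> twisted_basilica"
  unfolding twisted_basilica_def by (rule generate.incl, simp)+

lemma subgroup_twisted_basilica: "subgroup twisted_basilica AutT"
  unfolding twisted_basilica_def by (rule AutT.generate_is_subgroup) simp

lemma twisted_basilica_subset: "twisted_basilica \<subseteq> basilica"
  unfolding twisted_basilica_def
proof (rule AutT.generate_subgroup_incl[OF _ subgroup_basilica])
  have "twisted_a \<in> basilica"
    unfolding twisted_a_def by (intro basilica_comp gen_basilica gen_d_basilica)
  then show "{twisted_a, gen_alpha, gen_c0, gen_c1, gen_c2, gen_c3} \<subseteq> basilica" by simp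
qed

lemma basilica_generated_by_twisted_and_a:
  assumes K: "subgroup K AutT" and "K \<subseteq> basilica" "twisted_basilica \<subseteq> K" "gen_a \<in> K"
  shows "K = basilica"
proof
  have "basilica_gens \<subseteq> K" unfolding basilica_gens_def using assms twisted_gens_mem by blast
  then show "basilica \<subseteq> K"
    unfolding basilica_def by (rule AutT.generate_subgroup_incl[OF _ K])
qed (rule assms)

theorem theorem1p1:
  shows "\<exists>M. maximal_subgroup M (Bas_group 2 grigorchuk_erschler) \<and>
             infinite (rcosets\<^bsub>Bas_group 2 grigorchuk_erschler\<^esub> M)"
proof -
  define G where "G = AutT\<lparr>carrier := basilica\<rparr>"
  have G_eq: "Bas_group 2 grigorchuk_erschler = G"
    by (simp add: Bas_group_def Bas_eq_basilica G_def)
  interpret G: group G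
    unfolding G_def by (rule AutT.subgroup_imp_group[OF subgroup_basilica])
  have carrier_G [simp]: "carrier G = basilica" and mult_G [simp]: "\<And>x y. x \<otimes>\<^bsub>G\<^esub> y = x \<circ> y"
    and one_G [simp]: "\<one>\<^bsub>G\<^esub> = id" by (simp_all add: G_def)
  have inv_G [simp]: "m_inv G x = Ainv x" if "x \<in> basilica" for x
    using AutT.m_inv_consistent[OF subgroup_basilica that] by (simp only: G_def)
  have sub: "subgroup K AutT \<and> K \<subseteq> basilica" if K: "subgroup K G" for K
    using AutT.incl_subgroup[OF subgroup_basilica] K subgroup.subset[OF K] by (simp add: G_def)
  have "\<exists>M. maximal_subgroup M G \<and> twisted_basilica \<subseteq> M"
  proof (rule G.exists_maximal_subgroup_above)
    show "subgroup twisted_basilica G"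
      unfolding G_def
      by (rule AutT.subgroup_incl[OF subgroup_twisted_basilica subgroup_basilica twisted_basilica_subset])
    show "gen_a \<in> carrier G" by simp
    show "gen_a \<notin> twisted_basilica" by (rule gen_a_notin_twisted_basilica)
    show "K = carrier G" if "subgroup K G" "twisted_basilica \<subseteq> K" "gen_a \<in> K" for K
      using basilica_generated_by_twisted_and_a[of K] sub[OF that(1)] that by (simp only: carrier_G)
  qed
  then obtain M where max: "maximal_subgroup M G" and H: "twisted_basilica \<subseteq> M" by blast
  then have MG: "subgroup M G" and proper: "M \<noteq> basilica" by (simp_all add: maximal_subgroup_def)
  have M: "subgroup M AutT" "M \<subseteq> basilica" using sub[OF MG] by blast+
  have "infinite (rcosets\<^bsub>G\<^esub> M)"
  proof
    assume fin: "finite (rcosets\<^bsub>G\<^esub> M)"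
    obtain g where g: "g \<in> basilica" "g \<noteq> id" "\<And>x. x \<in> basilica \<Longrightarrow> x \<circ> g \<circ> Ainv x \<in> M"
      using G.finite_index_core_nontrivial[OF _ MG fin] infinite_basilica by auto
    \<comment> \<open>the normal core of \<open>M\<close>\<close>
    define N where "N = {g \<in> basilica. \<forall>x\<in>basilica. x \<circ> g \<circ> Ainv x \<in> M}"
    have N: "subgroup N AutT"
    proof (rule AutT.subgroupI)
      show "N \<subseteq> carrier AutT" using basilica_Aut by (auto simp: N_def)
      show "N \<noteq> {}" using g by (auto simp: N_def)
      show "Ainv h \<in> N" if h: "h \<in> N" for h
      proof -
        have hB: "h \<in> basilica" using h by (simp add: N_def)
        have "x \<circ> Ainv h \<circ> Ainv x \<in> M" if x: "x \<in> basilica" for x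
        proof -
          have "x \<circ> Ainv h \<circ> Ainv x = Ainv (x \<circ> h \<circ> Ainv x)"
            by (rule inv_AutT_unique[symmetric]) (use x hB basilica_Aut in simp_all)
          then show ?thesis
            using subgroup.m_inv_closed[OF M(1), of "x \<circ> h \<circ> Ainv x"] h x by (simp add: N_def)
        qed
        then show ?thesis using basilica_inv[OF hB] by (simp add: N_def)
      qed
      show "h \<otimes>\<^bsub>AutT\<^esub> k \<in> N" if h: "h \<in> N" and k: "k \<in> N" for h k
      proof -
        have B: "h \<in> basilica" "k \<in> basilica" using h k by (simp_all add: N_def)
        have "x \<circ> (h \<circ> k) \<circ> Ainv x \<in> M" if x: "x \<in> basilica" for x
        proof -
          have "x \<circ> (h \<circ> k) \<circ> Ainv x = (x \<circ> h \<circ> Ainv x) \<circ> (x \<circ> k \<circ> Ainv x)"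
            using x basilica_Aut by (simp add: fun_eq_iff)
          then show ?thesis
            using subgroup_AutT_comp[OF M(1), of "x \<circ> h \<circ> Ainv x" "x \<circ> k \<circ> Ainv x"] h k x
            by (simp add: N_def)
        qed
        then show ?thesis using basilica_comp[OF B] by (simp add: N_def)
      qed
    qed
    have "h \<circ> x \<circ> Ainv h \<in> N" if h: "h \<in> basilica" and x: "x \<in> N" for h x
    proof -
      have "y \<circ> (h \<circ> x \<circ> Ainv h) \<circ> Ainv y \<in> M" if y: "y \<in> basilica" for y
      proof -
        have "(y \<circ> h) \<circ> x \<circ> Ainv (y \<circ> h) \<in> M"
          using x basilica_comp[OF y h] by (simp add: N_def)
        moreover have "(y \<circ> h) \<circ> x \<circ> Ainv (y \<circ> h) = y \<circ> (h \<circ> x \<circ> Ainv h) \<circ> Ainv y"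
          using y h basilica_Aut by (simp add: inv_comp_AutT fun_eq_iff)
        ultimately show ?thesis by (simp only:)
      qed
      moreover have "h \<circ> x \<circ> Ainv h \<in> basilica"
        using h x by (intro basilica_comp basilica_inv) (simp_all add: N_def)
      ultimately show ?thesis by (simp add: N_def)
    qed
    then obtain k where k: "transl ^^ (2 ^ k) \<in> N"
      using normal_contains_transl_power[OF N, of g] g by (auto simp: N_def)
    have "N \<subseteq> M"
    proof
      fix h assume h: "h \<in> N"
      have "id \<circ> h \<circ> Ainv id \<in> M"
        using h subgroup_AutT_id[OF subgroup_basilica] by (simp only: N_def mem_Collect_eq)
      moreover have "id \<circ> h \<circ> Ainv id = h" using inv_AutT_apply(1)[OF id_Aut] by (intro ext) simp
      ultimately show "h \<in> M" by (simp only:)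
    qed
    then have two: "transl ^^ (2 ^ k) \<in> M" using k by blast
    have d: "gen_d \<in> M"
      unfolding gen_d_def using H twisted_gens_mem by (intro subgroup_AutT_comp[OF M(1)]) blast+
    have "transl ^^ 3 = twisted_a \<circ> gen_d" by (simp add: twisted_a_def transl_def numeral_3_eq_3 comp_assoc)
    then have "transl ^^ 3 \<in> M"
      using subgroup_AutT_comp[OF M(1) _ d, of twisted_a] H twisted_gens_mem(1) by auto
    then have "transl \<in> M" using transl_mem_of_powers[OF M(1) _ two] by blast
    then have "transl \<circ> gen_d \<in> M" using d by (rule subgroup_AutT_comp[OF M(1)])
    moreover have "transl \<circ> gen_d = gen_a" by (rule ext) (simp add: transl_def)
    ultimately have "gen_a \<in> M" by (simp only:)
    then show False
      using basilica_generated_by_twisted_and_a[OF M H] proper by blast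
  qed
  then show ?thesis using max G_eq by blast
qed

end
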